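(* Let $g:\mathbb{N}\to\mathbb{R}$ with $g(t)\to\infty$. There is $t_0$ such that for every $t\ge t_0$, every integer $k$ with $1\le k<t$ and $\min(k,t-k)\ge g(t)\,t^{1/2}(\log_2 t)^{5/4}$, and every $n$, every graph on $n$ vertices with no $K_t$-minor contains at most \[ n\cdot\frac{C^*_t(k)}{|V(T^*_t(k))|}\cdot 2^{8t^{1/2}(\log_2 t)^{5/4}}\] cliques of order $k$.
   Context: For integers $N\ge\omega\ge1$, the Turán graph $T(N,\omega)$ is the complete $\omega$-partite graph on $N$ vertices with part sizes $\lfloor N/\omega\rfloor$ or $\lceil N/\omega\rceil$. For integers $1\le k<t$, $T^*_t(k)$ is the Turán graph $T(2t-\omega-1,\omega)$ maximizing the number of cliques of order $k$ among all $\omega$ with $k\le\omega\le t-1$, and $C^*_t(k)$ is the number of cliques of order $k$ in $T^*_t(k)$. *)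

theory Defs
  imports Complex_Main "HOL-Library.Ramsey" "HOL-Library.Disjoint_Sets"
begin

text \<open>
  A graph is given by its vertex set \<open>V\<close> and its set \<open>E\<close> of two-element edges; \<open>[V]\<^bsup>2\<^esup>\<close>
  is the edge set of the complete graph on \<open>V\<close>.
\<close>

definition simple_graph :: "'a set \<Rightarrow> 'a set set \<Rightarrow> bool" where
  "simple_graph V E \<longleftrightarrow> finite V \<and> E \<subseteq> [V]\<^bsup>2\<^esup>"

text \<open>Cliques are complete subgraphs, not necessarily maximal, identified with their vertex sets.\<close>

definition num_cliques :: "nat \<Rightarrow> 'a set \<Rightarrow> 'a set set \<Rightarrow> nat" where
  "num_cliques k V E = card {K \<in> [V]\<^bsup>k\<^esup>. clique K E}"

definition induces_connected :: "'a set set \<Rightarrow> 'a set \<Rightarrow> bool" where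
  "induces_connected E S \<longleftrightarrow> S \<noteq> {} \<and>
     (\<forall>u\<in>S. \<forall>v\<in>S. (u, v) \<in> {(a, b). a \<in> S \<and> b \<in> S \<and> {a, b} \<in> E}\<^sup>*)"

text \<open>
  \<open>(W, F)\<close> is a minor of \<open>(V, E)\<close>: contracting the pairwise disjoint connected branch sets
  \<open>\<phi> x\<close> in a subgraph of \<open>(V, E)\<close> yields \<open>(W, F)\<close>.
\<close>

definition is_minor :: "'b set \<Rightarrow> 'b set set \<Rightarrow> 'a set \<Rightarrow> 'a set set \<Rightarrow> bool" where
  "is_minor W F V E \<longleftrightarrow> (\<exists>\<phi> :: 'b \<Rightarrow> 'a set.
     (\<forall>x\<in>W. \<phi> x \<subseteq> V \<and> induces_connected E (\<phi> x)) \<and>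
     disjoint_family_on \<phi> W \<and>
     (\<forall>x\<in>W. \<forall>y\<in>W. {x, y} \<in> F \<longrightarrow> (\<exists>u\<in>\<phi> x. \<exists>v\<in>\<phi> y. {u, v} \<in> E)))"

definition has_complete_minor :: "nat \<Rightarrow> 'a set \<Rightarrow> 'a set set \<Rightarrow> bool" where
  "has_complete_minor t V E \<longleftrightarrow> is_minor {..<t} ([{..<t}]\<^bsup>2\<^esup>) V E"

definition complete_multipartite_edges :: "'a set set \<Rightarrow> 'a set set" where
  "complete_multipartite_edges P = {{x, y} | x y. \<exists>p\<in>P. \<exists>q\<in>P. p \<noteq> q \<and> x \<in> p \<and> y \<in> q}"

text \<open>
  The Turan graph is only determined up to isomorphism, so \<open>(V, E)\<close> is required to be
  a copy of it.
\<close>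

definition is_turan_graph :: "nat \<Rightarrow> nat \<Rightarrow> 'a set \<Rightarrow> 'a set set \<Rightarrow> bool" where
  "is_turan_graph N \<omega> V E \<longleftrightarrow> finite V \<and> card V = N \<and>
     (\<exists>P. partition_on V P \<and> card P = \<omega> \<and>
        (\<forall>p\<in>P. int (card p) \<in> {\<lfloor>real N / real \<omega>\<rfloor>, \<lceil>real N / real \<omega>\<rceil>}) \<and>
        E = complete_multipartite_edges P)"

text \<open>
  \<open>(V, E)\<close> is a copy of an extremal Turan graph \<open>T\<^sup>*\<^sub>t(k)\<close>. Several \<open>\<omega>\<close> may attain the maximum,
  with different numbers of vertices, so this too is a predicate. The vertex type is infinite
  so that all competing graphs have copies in it.
\<close>

definition is_extremal_turan :: "nat \<Rightarrow> nat \<Rightarrow> nat set \<Rightarrow> nat set set \<Rightarrow> bool" where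
  "is_extremal_turan t k V E \<longleftrightarrow>
     (\<exists>\<omega>\<in>{k..t - 1}. is_turan_graph (2 * t - \<omega> - 1) \<omega> V E) \<and>
     (\<forall>\<omega>'\<in>{k..t - 1}. \<forall>(V' :: nat set) E'. is_turan_graph (2 * t - \<omega>' - 1) \<omega>' V' E' \<longrightarrow>
        num_cliques k V' E' \<le> num_cliques k V E)"

text \<open>Both predicates are satisfiable in the relevant parameter ranges.\<close>

lemma card_residue_class:
  fixes N w r :: nat
  assumes "r < w"
  shows "card {i. i < N \<and> i mod w = r} = N div w + (if r < N mod w then 1 else 0)"
proof -
  let ?m = "N div w + (if r < N mod w then 1 else 0)"
  have N: "N = w * (N div w) + N mod w" by simp
  have lt: "r + w * j < N \<longleftrightarrow> j < ?m" for j
  proof -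
    have m: "N mod w < w" using assms by simp
    consider "Suc j \<le> N div w" | "j = N div w" | "Suc (N div w) \<le> j" by linarith
    then show ?thesis
    proof cases
      case 1
      then have "w * Suc j \<le> w * (N div w)" by (rule mult_le_mono2)
      then have "r + w * j < N" using N assms unfolding mult_Suc_right by linarith
      then show ?thesis using 1 by simp
    next
      case 2
      have "r + w * j < N \<longleftrightarrow> r < N mod w" unfolding 2 using N by linarith
      then show ?thesis using 2 by simp
    next
      case 3
      then have "w * Suc (N div w) \<le> w * j" by (rule mult_le_mono2)
      then have "\<not> r + w * j < N" using N m unfolding mult_Suc_right by linarith
      then show ?thesis using 3 by simp
    qed
  qed
  have "{i. i < N \<and> i mod w = r} = (\<lambda>j. r + w * j) ` {..<?m}"
  proof (intro set_eqI iffI)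
    fix i assume i: "i \<in> {i. i < N \<and> i mod w = r}"
    then have "i = r + w * (i div w)" by (metis (mono_tags) mem_Collect_eq mod_mult_div_eq)
    then show "i \<in> (\<lambda>j. r + w * j) ` {..<?m}" using i lt[of "i div w"] by auto
  next
    fix i assume "i \<in> (\<lambda>j. r + w * j) ` {..<?m}"
    then obtain j where j: "j < ?m" "i = r + w * j" by blast
    have "i < N" unfolding j(2) lt by (rule j(1))
    moreover have "i mod w = r" unfolding j(2) using assms by simp
    ultimately show "i \<in> {i. i < N \<and> i mod w = r}" by simp
  qed
  moreover have "inj_on (\<lambda>j. r + w * j) {..<?m}" using assms by (auto simp: inj_on_def)
  ultimately show ?thesis by (simp add: card_image)
qed

lemma turan_graph_exists:
  assumes "1 \<le> w" "w \<le> N"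
  shows "\<exists>(V :: nat set) E. is_turan_graph N w V E"
proof -
  let ?c = "\<lambda>r. {i. i < N \<and> i mod w = r}"
  let ?P = "?c ` {..<w}"
  have ne: "r \<in> ?c r" if "r < w" for r using that assms by auto
  have inj: "inj_on ?c {..<w}"
  proof (rule inj_onI)
    fix r s assume "r \<in> {..<w}" "s \<in> {..<w}" "?c r = ?c s"
    then show "r = s" using ne[of r] by auto
  qed
  have part: "partition_on {..<N} ?P"
  proof (rule partition_onI)
    show "\<Union>?P = {..<N}" using assms by auto
    show "{} \<notin> ?P" using ne by blast
    show "disjnt p q" if "p \<in> ?P" "q \<in> ?P" "p \<noteq> q" for p q
      using that by (auto simp: disjnt_def)
  qed
  have size: "int (card p) \<in> {\<lfloor>real N / real w\<rfloor>, \<lceil>real N / real w\<rceil>}" if p: "p \<in> ?P" for p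
  proof -
    from p obtain r where r: "r < w" "p = ?c r" by auto
    have c: "card p = N div w + (if r < N mod w then 1 else 0)"
      unfolding r(2) by (rule card_residue_class[OF r(1)])
    have fl: "\<lfloor>real N / real w\<rfloor> = int (N div w)" by (simp add: floor_divide_of_nat_eq)
    show ?thesis
    proof (cases "r < N mod w")
      case False
      then show ?thesis using c fl by simp
    next
      case True
      then have "\<not> w dvd N" by (metis dvd_imp_mod_0 not_less_zero)
      have "real N / real w \<noteq> of_int \<lfloor>real N / real w\<rfloor>"
      proof
        assume "real N / real w = of_int \<lfloor>real N / real w\<rfloor>"
        then have "real N = real (N div w) * real w" using assms fl by (simp add: field_simps)
        then have "N = N div w * w" by (metis of_nat_eq_iff of_nat_mult)
        then show False using \<open>\<not> w dvd N\<close> by (metis dvd_triv_right)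
      qed
      then have "\<lceil>real N / real w\<rceil> = \<lfloor>real N / real w\<rfloor> + 1"
        unfolding ceiling_altdef by simp
      then show ?thesis using c fl True by simp
    qed
  qed
  have "is_turan_graph N w {..<N} (complete_multipartite_edges ?P)"
    unfolding is_turan_graph_def
  proof (intro conjI exI[of _ ?P])
    show "card ?P = w" using inj by (simp add: card_image)
    show "\<forall>p\<in>?P. int (card p) \<in> {\<lfloor>real N / real w\<rfloor>, \<lceil>real N / real w\<rceil>}" using size by blast
  qed (use part in simp_all)
  then show ?thesis by blast
qed

lemma extremal_turan_exists:
  assumes "1 \<le> k" "k < t"
  shows "\<exists>V E. is_extremal_turan t k V E"
proof -
  define S where "S = {m. \<exists>(V :: nat set) E. m = num_cliques k V E \<and>
    (\<exists>w\<in>{k..t - 1}. is_turan_graph (2 * t - w - 1) w V E)}"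
  have bound: "m \<le> 2 ^ (2 * t)" if m: "m \<in> S" for m
  proof -
    from m obtain V :: "nat set" and E w where V: "m = num_cliques k V E" "is_turan_graph (2 * t - w - 1) w V E"
      unfolding S_def by blast
    then have fin: "finite V" and c: "card V \<le> 2 * t" unfolding is_turan_graph_def by simp_all
    have "m \<le> card (Pow V)" unfolding V(1) num_cliques_def
      using fin by (intro card_mono) (auto simp: nsets_def)
    also have "\<dots> \<le> 2 ^ (2 * t)" using fin c by (simp add: card_Pow)
    finally show ?thesis .
  qed
  have "k \<le> 2 * t - k - 1" using assms by linarith
  then obtain V :: "nat set" and E where "is_turan_graph (2 * t - k - 1) k V E"
    using turan_graph_exists[OF assms(1)] by blast
  moreover have "k \<in> {k..t - 1}" using assms by simp
  ultimately have ne: "S \<noteq> {}" unfolding S_def by blast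
  have fin: "finite S" using bound finite_nat_set_iff_bounded_le by blast
  have "Max S \<in> S" using fin ne by (rule Max_in)
  then obtain V :: "nat set" and E w where M: "Max S = num_cliques k V E" "w \<in> {k..t - 1}"
    "is_turan_graph (2 * t - w - 1) w V E" unfolding S_def by blast
  have "num_cliques k V' E' \<le> num_cliques k V E"
    if "w' \<in> {k..t - 1}" "is_turan_graph (2 * t - w' - 1) w' V' E'" for w' and V' :: "nat set" and E'
  proof -
    have "num_cliques k V' E' \<in> S" using that unfolding S_def by blast
    then show ?thesis using fin unfolding M(1)[symmetric] by (rule Max_ge[rotated])
  qed
  then show ?thesis using M(2,3) unfolding is_extremal_turan_def by blast
qed

end

theory Submission
  imports Defs "HOL-Library.Multiset" "HOL-Computational_Algebra.Polynomial" "HOL-Real_Asymp.Real_Asymp"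
begin

text \<open>
  If every vertex of a graph on a vertex set \<open>R\<close> has at most \<open>q\<close> non-neighbours in \<open>R\<close>, then, apart
  from at most \<open>q\<^sup>2\<close> of them, the vertices outside a maximum clique can be grouped greedily into
  dominating adjacent pairs. Together with the vertices of the clique these are the branch sets of a
  complete minor, so if there is no \<open>K\<^sub>t\<close>-minor, some vertex has more than the square root of
  \<open>card R + \<omega> + 1 - 2t\<close> non-neighbours, where \<open>\<omega>\<close> is the clique number. Locate a \<open>k\<close>-clique by
  branching on such vertices: choosing one into the clique discards all its non-neighbours, so after
  \<open>O(sqrt t)\<close> choices, each costing a factor polynomial in \<open>t\<close>, at most \<open>2t - \<omega> - 1\<close> vertices remain.
  By Zykov's theorem the remaining graph has at most as many cliques as the Turan graph
  \<open>T(2t - \<omega> - 1, \<omega>)\<close>, and replacing \<open>k\<close> minus the number of choices by \<open>k\<close>, and \<open>\<omega>\<close> by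
  \<open>max \<omega> k\<close>, again costs a factor \<open>t\<close> to the power \<open>O(sqrt t)\<close>.

  To start with \<open>O(t)\<close> vertices, one first peels in the same way a set of fewer than \<open>t\<^sup>3\<close> vertices,
  using branch sets of bounded size instead of pairs. Such sets suffice because a graph without
  \<open>K\<^sub>t\<close>-minor has a vertex of degree less than \<open>t\<^sup>3\<close>: otherwise contracting edges that lie in few
  triangles produces a neighbourhood of density \<open>1/2\<close>, contracting again for an edge threshold growing like
  the power \<open>3/2\<close> of the number of vertices raises this to \<open>3/4\<close>, and then greedy connected dominating sets
  of logarithmic size give the minor.
\<close>

subsection \<open>Complete minors from dominating connected sets\<close>

locale ugraph =
  fixes adj :: "'v \<Rightarrow> 'v \<Rightarrow> bool"
  assumes adj_sym: "adj u v \<Longrightarrow> adj v u" and adj_irrefl: "\<not> adj v v"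
begin

abbreviation step_in :: "'v set \<Rightarrow> 'v \<Rightarrow> 'v \<Rightarrow> bool" where
  "step_in S \<equiv> \<lambda>a b. a \<in> S \<and> b \<in> S \<and> adj a b"

definition conn :: "'v set \<Rightarrow> bool" where
  "conn S \<longleftrightarrow> S \<noteq> {} \<and> (\<forall>u\<in>S. \<forall>v\<in>S. (step_in S)\<^sup>*\<^sup>* u v)"

definition touch :: "'v set \<Rightarrow> 'v set \<Rightarrow> bool" where
  "touch A B \<longleftrightarrow> (\<exists>a\<in>A. \<exists>b\<in>B. adj a b)"

text \<open>Members carry no index, so contracting an edge just replaces two members by their union.
  Nonemptiness comes from \<open>conn\<close>.\<close>

definition branch_family :: "'v set \<Rightarrow> 'v set set \<Rightarrow> bool" where
  "branch_family R P \<longleftrightarrow> finite P \<and> \<Union>P \<subseteq> R \<and> (\<forall>A\<in>P. conn A) \<and> disjoint P"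

definition cminor :: "'v set \<Rightarrow> nat \<Rightarrow> bool" where
  "cminor R t \<longleftrightarrow> (\<exists>P. branch_family R P \<and> card P = t \<and> (\<forall>A\<in>P. \<forall>B\<in>P. A \<noteq> B \<longrightarrow> touch A B))"

definition nb :: "'v set \<Rightarrow> 'v \<Rightarrow> 'v set" where
  "nb R v = {u \<in> R. adj v u}"

text \<open>A vertex of \<open>R\<close> belongs to its own set of non-neighbours.\<close>

definition nonnb :: "'v set \<Rightarrow> 'v \<Rightarrow> 'v set" where
  "nonnb R v = {u \<in> R. \<not> adj v u}"

definition is_clique :: "'v set \<Rightarrow> bool" where
  "is_clique C \<longleftrightarrow> (\<forall>u\<in>C. \<forall>v\<in>C. u \<noteq> v \<longrightarrow> adj u v)"

lemma finite_nb [simp]: "finite R \<Longrightarrow> finite (nb R v)"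
  and finite_nonnb [simp]: "finite R \<Longrightarrow> finite (nonnb R v)"
  by (auto simp: nb_def nonnb_def)

lemma card_nb_nonnb: "finite R \<Longrightarrow> card (nb R v) + card (nonnb R v) = card R"
  by (subst card_Un_disjoint [symmetric]) (auto simp: nb_def nonnb_def intro: arg_cong[of _ _ card])

lemma conn_from_centre:
  assumes "c \<in> S" "\<And>u. u \<in> S \<Longrightarrow> (step_in S)\<^sup>*\<^sup>* c u"
  shows "conn S"
proof -
  have "symp (step_in S)" by (auto intro!: sympI dest: adj_sym)
  then have "(step_in S)\<^sup>*\<^sup>* u c" if "u \<in> S" for u
    using assms(2)[OF that] by (metis symp_rtranclp sympE)
  then show ?thesis unfolding conn_def using assms by (meson empty_iff rtranclp_trans)
qed

lemma conn_singleton: "conn {v}"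
  by (rule conn_from_centre[of v]) auto

lemma conn_pair: "adj u v \<Longrightarrow> conn {u, v}"
  by (rule conn_from_centre[of u]) auto

lemma branch_family_mono: "branch_family R P \<Longrightarrow> R \<subseteq> S \<Longrightarrow> branch_family S P"
  unfolding branch_family_def by auto

lemma branch_family_subset: "branch_family R P \<Longrightarrow> P' \<subseteq> P \<Longrightarrow> branch_family R P'"
  unfolding branch_family_def using finite_subset[of P' P] Union_mono[of P' P] pairwise_subset[of disjnt P P']
  by (metis subset_iff subset_trans)

lemma cminor_antimono:
  assumes "cminor R n" "t \<le> n"
  shows "cminor R t"
proof -
  obtain P where P: "branch_family R P" "card P = n" "\<forall>A\<in>P. \<forall>B\<in>P. A \<noteq> B \<longrightarrow> touch A B"
    using assms(1) unfolding cminor_def by blast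
  obtain P' where "P' \<subseteq> P" "card P' = t" using obtain_subset_with_card_n[of t P] P(2) assms(2) by blast
  moreover have "branch_family R P'" using P(1) \<open>P' \<subseteq> P\<close> by (rule branch_family_subset)
  ultimately show ?thesis using P(3) unfolding cminor_def by blast
qed

lemma cminor_mono: "cminor R t \<Longrightarrow> R \<subseteq> S \<Longrightarrow> cminor S t"
  unfolding cminor_def using branch_family_mono by metis

text \<open>A set \<open>T\<close> supplied by \<open>dom\<close> contains a neighbour of every
  vertex of \<open>R\<close>, so it touches every singleton of \<open>K\<close> and every other
  branch set. Each choice uses up at most \<open>r\<close> vertices of \<open>U\<close>, and
  \<open>size\<close> leaves at least \<open>m\<close> before the last choice; \<open>r\<close> is
  added on the right to avoid truncated subtraction.\<close>

lemma greedy_minor: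
  assumes fin: "finite R" and K: "K \<subseteq> R" "is_clique K" and U: "U \<subseteq> R" "U \<inter> K = {}"
    and dom: "\<And>U'. U' \<subseteq> U \<Longrightarrow> m \<le> card U' \<Longrightarrow>
      \<exists>T\<subseteq>U'. card T \<le> r \<and> conn T \<and> (\<forall>v\<in>R. \<exists>s\<in>T. adj v s)"
    and size: "m + r * p \<le> card U + r"
  shows "cminor R (card K + p)"
proof -
  have finU: "finite U" and finK: "finite K" using fin K(1) U(1) by (auto intro: finite_subset)
  have "\<exists>P. branch_family U P \<and> card P = p \<and> card (\<Union>P) \<le> r * p \<and> (\<forall>T\<in>P. \<forall>v\<in>R. \<exists>s\<in>T. adj v s)"
    using size
  proof (induction p)
    case 0
    show ?case by (rule exI[of _ "{}"]) (auto simp: branch_family_def)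
  next
    case (Suc p)
    then obtain P where P: "branch_family U P" "card P = p" "card (\<Union>P) \<le> r * p"
      "\<forall>T\<in>P. \<forall>v\<in>R. \<exists>s\<in>T. adj v s" by auto
    have sub: "\<Union>P \<subseteq> U" using P(1) unfolding branch_family_def by blast
    have "card (U - \<Union>P) = card U - card (\<Union>P)" using sub finU by (meson card_Diff_subset finite_subset)
    then have "m \<le> card (U - \<Union>P)" using P(3) Suc.prems by simp
    then obtain T where T: "T \<subseteq> U - \<Union>P" "card T \<le> r" "conn T" "\<forall>v\<in>R. \<exists>s\<in>T. adj v s"
      using dom[of "U - \<Union>P"] by blast
    have ne: "T \<noteq> {}" using T(3) conn_def by blast
    have "T \<notin> P" using T(1) ne by blast
    moreover have "card (\<Union>(insert T P)) \<le> r * Suc p"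
      using card_Un_le[of T "\<Union>P"] P(3) T(2) by simp
    moreover have "branch_family U (insert T P)" using P(1) T(1,3)
      unfolding branch_family_def by (auto simp: disjoint_def)
    ultimately show ?case using P(2,4) T(4)
      by (intro exI[of _ "insert T P"]) (auto simp: branch_family_def)
  qed
  then obtain P where P: "branch_family U P" "card P = p" "\<forall>T\<in>P. \<forall>v\<in>R. \<exists>s\<in>T. adj v s" by blast
  let ?S = "(\<lambda>x. {x}) ` K"
  have sub: "A \<subseteq> U" "A \<noteq> {}" if "A \<in> P" for A using that P(1) unfolding branch_family_def conn_def by auto
  have disj: "?S \<inter> P = {}" using sub U(2) by fastforce
  have "card (?S \<union> P) = card K + p"
    using disj P(1,2) finK by (subst card_Un_disjoint) (auto simp: branch_family_def card_image)
  moreover have "branch_family R (?S \<union> P)"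
    unfolding branch_family_def
  proof (intro conjI)
    show "finite (?S \<union> P)" using P(1) finK by (simp add: branch_family_def)
    show "\<Union>(?S \<union> P) \<subseteq> R" using sub(1) K(1) U(1) by auto
    show "\<forall>A\<in>?S \<union> P. conn A" using P(1) conn_singleton by (auto simp: branch_family_def)
    show "disjoint (?S \<union> P)"
    proof (rule disjoint_union)
      show "disjoint ?S" by (auto simp: disjoint_def)
      show "disjoint P" using P(1) by (simp add: branch_family_def)
      show "\<Union>?S \<inter> \<Union>P = {}" using sub(1) U(2) by fastforce
    qed
  qed
  moreover have "touch A B" if AB: "A \<in> ?S \<union> P" "B \<in> ?S \<union> P" "A \<noteq> B" for A B
  proof -
    have PB: "touch X T" "touch T X" if T: "T \<in> P" and X: "X \<in> ?S \<union> P" for T X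
    proof -
      have "X \<subseteq> R" "X \<noteq> {}" using X sub U K by auto
      then obtain v where "v \<in> X" "v \<in> R" by blast
      then obtain s where "s \<in> T" "adj v s" using P(3) T by blast
      then have "adj v s" "adj s v" by (simp_all add: adj_sym)
      then show "touch X T" "touch T X" using \<open>v \<in> X\<close> \<open>s \<in> T\<close> unfolding touch_def by blast+
    qed
    show ?thesis
    proof (cases "A \<in> P \<or> B \<in> P")
      case True then show ?thesis using PB AB by blast
    next
      case False
      then show ?thesis using AB K(2) unfolding is_clique_def touch_def by auto
    qed
  qed
  ultimately show ?thesis unfolding cminor_def by blast
qed

lemma clique_minor:
  assumes "finite R" "K \<subseteq> R" "is_clique K"
  shows "cminor R (card K)"
  using greedy_minor[of R K "{}" 1 1 0] assms by auto

text \<open>Any \<open>a\<close> in \<open>U\<close> misses at most \<open>q\<close> vertices, which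
  together have at most \<open>q ^ 2\<close> non-neighbours; a \<open>b\<close> in \<open>U\<close>
  outside these dominates all that \<open>a\<close> misses. As \<open>a\<close> is its own
  non-neighbour, \<open>b\<close> is also adjacent to \<open>a\<close>.\<close>

lemma dominating_pair:
  assumes fin: "finite R" and U: "U \<subseteq> R" "q ^ 2 < card U"
    and q: "\<And>v. v \<in> R \<Longrightarrow> card (nonnb R v) \<le> q"
  shows "\<exists>T\<subseteq>U. card T \<le> 2 \<and> conn T \<and> (\<forall>v\<in>R. \<exists>s\<in>T. adj v s)"
proof -
  obtain a where a: "a \<in> U" using U(2) by (metis card.empty equals0I not_less_zero)
  let ?Z = "nonnb R a"
  let ?X = "\<Union>z\<in>?Z. nonnb R z"
  have finZ: "finite ?Z" using fin by simp
  have "card ?X \<le> (\<Sum>z\<in>?Z. card (nonnb R z))" by (rule card_UN_le[OF finZ])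
  also have "\<dots> \<le> (\<Sum>z\<in>?Z. q)" by (rule sum_mono) (use q in \<open>auto simp: nonnb_def\<close>)
  also have "\<dots> \<le> q ^ 2" using q[of a] a U(1) by (auto simp: power2_eq_square)
  finally have "card ?X < card U" using U(2) by simp
  moreover have "finite ?X" using finZ fin by simp
  ultimately obtain b where b: "b \<in> U" "b \<notin> ?X" by (meson card_mono not_le subsetI)
  have aR: "a \<in> ?Z" using a U by (auto simp: nonnb_def adj_irrefl)
  then have "adj a b" using b U unfolding nonnb_def by blast
  then have "conn {a, b}" by (rule conn_pair)
  moreover have "\<exists>s\<in>{a, b}. adj v s" if "v \<in> R" for v
    using that b U adj_sym unfolding nonnb_def by blast
  ultimately show ?thesis using a b by (intro exI[of _ "{a, b}"]) (auto simp: card_insert_if)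
qed

text \<open>
  A set of \<open>r\<close> vertices, each chosen to reduce the undominated part by the factor \<open>b\<close>, dominates
  everything; common neighbours with one of its members make it connected.
\<close>

lemma dominating_connected:
  assumes fin: "finite R" and U: "U \<subseteq> R" "b * q \<le> card U"
    and b: "3 \<le> b" and r: "card R < b ^ r" and ne: "R \<noteq> {}"
    and q: "\<And>v. v \<in> R \<Longrightarrow> card (nonnb R v) \<le> q"
  shows "\<exists>T\<subseteq>U. card T \<le> 2 * r \<and> conn T \<and> (\<forall>v\<in>R. \<exists>s\<in>T. adj v s)"
proof -
  have finU: "finite U" using fin U finite_subset by blast
  have q0: "0 < q"
  proof -
    obtain v where "v \<in> R" using ne by blast
    then have "v \<in> nonnb R v" by (simp add: nonnb_def adj_irrefl)
    then have "0 < card (nonnb R v)" using fin by (metis card_gt_0_iff empty_iff finite_nonnb)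
    then show ?thesis using q[OF \<open>v \<in> R\<close>] by simp
  qed
  have three: "3 * q \<le> card U" using U(2) b by (meson le_trans mult_le_mono1)
  have nn: "card {u \<in> U. \<not> adj v u} \<le> q" if "v \<in> R" for v
  proof -
    have "card {u \<in> U. \<not> adj v u} \<le> card (nonnb R v)"
      using U fin by (intro card_mono) (auto simp: nonnb_def)
    then show ?thesis using q[OF that] by simp
  qed
  have "\<exists>S\<subseteq>U. card S \<le> i \<and> b ^ i * card {w \<in> R. \<forall>s\<in>S. \<not> adj w s} \<le> card R" for i
  proof (induction i)
    case 0
    show ?case by (rule exI[of _ "{}"]) auto
  next
    case (Suc i)
    then obtain S where S: "S \<subseteq> U" "card S \<le> i" "b ^ i * card {w \<in> R. \<forall>s\<in>S. \<not> adj w s} \<le> card R" by blast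
    let ?W = "{w \<in> R. \<forall>s\<in>S. \<not> adj w s}"
    have finW: "finite ?W" using fin by simp
    have "\<exists>u\<in>U. b * card {w \<in> ?W. \<not> adj w u} \<le> card ?W"
    proof (rule ccontr)
      assume "\<not> ?thesis"
      then have less: "card ?W < b * card {w \<in> ?W. \<not> adj w u}" if "u \<in> U" for u using that by force
      have U0: "U \<noteq> {}" using three q0 by auto
      \<comment> \<open>Double counting of non-adjacent pairs between \<open>U\<close> and
        \<open>?W\<close>: each vertex of \<open>?W\<close> lies in at most \<open>q\<close> of
        them, and \<open>b * q\<close> is at most \<open>card U\<close>.\<close>
      have "card U * card ?W = (\<Sum>u\<in>U. card ?W)" by simp
      also have "\<dots> < (\<Sum>u\<in>U. b * card {w \<in> ?W. \<not> adj w u})"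
        using less finU U0 by (intro sum_strict_mono) auto
      also have "\<dots> = b * (\<Sum>u\<in>U. card {w \<in> ?W. \<not> adj w u})" by (simp add: sum_distrib_left)
      also have "(\<Sum>u\<in>U. card {w \<in> ?W. \<not> adj w u}) = (\<Sum>w\<in>?W. card {u \<in> U. \<not> adj w u})"
        using sum.swap_restrict[OF finU finW, of "\<lambda>_ _. 1::nat" "\<lambda>u w. \<not> adj w u"] by simp
      also have "\<dots> \<le> (\<Sum>w\<in>?W. q)" by (rule sum_mono) (use nn in auto)
      also have "\<dots> = card ?W * q" by simp
      finally have "card U * card ?W < b * q * card ?W" by (simp add: ac_simps)
      then show False using U(2) by (simp add: not_less[symmetric])
    qed
    then obtain u where u: "u \<in> U" "b * card {w \<in> ?W. \<not> adj w u} \<le> card ?W" by blast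
    have "{w \<in> R. \<forall>s\<in>insert u S. \<not> adj w s} = {w \<in> ?W. \<not> adj w u}" by auto
    then have "b ^ Suc i * card {w \<in> R. \<forall>s\<in>insert u S. \<not> adj w s} = b ^ i * (b * card {w \<in> ?W. \<not> adj w u})"
      by (simp add: ac_simps)
    also have "\<dots> \<le> b ^ i * card ?W" using u(2) by (rule mult_le_mono2)
    also have "\<dots> \<le> card R" by (rule S(3))
    finally have "b ^ Suc i * card {w \<in> R. \<forall>s\<in>insert u S. \<not> adj w s} \<le> card R" .
    moreover have "card (insert u S) \<le> Suc i"
      using S(2) finite_subset[OF S(1) finU] by (simp add: card_insert_if)
    ultimately show ?case using u S(1) by (intro exI[of _ "insert u S"]) auto
  qed
  then obtain S where S: "S \<subseteq> U" "card S \<le> r" "b ^ r * card {w \<in> R. \<forall>s\<in>S. \<not> adj w s} \<le> card R" by blast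
  have "card {w \<in> R. \<forall>s\<in>S. \<not> adj w s} = 0"
  proof (rule ccontr)
    assume "card {w \<in> R. \<forall>s\<in>S. \<not> adj w s} \<noteq> 0"
    then have "b ^ r * 1 \<le> b ^ r * card {w \<in> R. \<forall>s\<in>S. \<not> adj w s}" by (intro mult_le_mono2) simp
    then show False using S(3) r by linarith
  qed
  then have dom: "\<exists>s\<in>S. adj v s" if "v \<in> R" for v using that fin by auto
  then obtain c where c: "c \<in> S" using ne by blast
  \<comment> \<open>\<open>c\<close> and \<open>s\<close> together exclude at most
    \<open>2 * q\<close> of the at least \<open>3 * q\<close> vertices of \<open>U\<close>.\<close>
  have "\<exists>x\<in>U. adj c x \<and> adj s x" if "s \<in> S" for s
  proof (rule ccontr)
    assume "\<not> ?thesis"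
    then have "U \<subseteq> {u \<in> U. \<not> adj c u} \<union> {u \<in> U. \<not> adj s u}" by blast
    then have "card U \<le> card ({u \<in> U. \<not> adj c u} \<union> {u \<in> U. \<not> adj s u})" using finU by (intro card_mono) auto
    also have "\<dots> \<le> q + q" using nn[of c] nn[of s] card_Un_le[of "{u \<in> U. \<not> adj c u}" "{u \<in> U. \<not> adj s u}"] c that S(1) U(1)
      by fastforce
    finally show False using three q0 by simp
  qed
  then obtain h where h: "\<And>s. s \<in> S \<Longrightarrow> h s \<in> U \<and> adj c (h s) \<and> adj s (h s)" by metis
  let ?T = "S \<union> h ` S"
  have finS: "finite S" using S(1) finU finite_subset by blast
  have "card ?T \<le> 2 * r" using card_Un_le[of S "h ` S"] card_image_le[OF finS, of h] S(2) by linarith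
  moreover have "conn ?T"
  proof (rule conn_from_centre[of c])
    show "c \<in> ?T" using c by simp
    fix u assume u: "u \<in> ?T"
    have st: "(step_in ?T) c (h s)" "(step_in ?T) (h s) s" if "s \<in> S" for s using h[OF that] that c adj_sym by auto
    have "(step_in ?T)\<^sup>*\<^sup>* c (h s)" "(step_in ?T)\<^sup>*\<^sup>* c s" if "s \<in> S" for s
    proof -
      show "(step_in ?T)\<^sup>*\<^sup>* c (h s)" using st(1)[OF that] by (rule r_into_rtranclp)
      then show "(step_in ?T)\<^sup>*\<^sup>* c s" using st(2)[OF that] by (rule rtranclp.rtrancl_into_rtrancl)
    qed
    then show "(step_in ?T)\<^sup>*\<^sup>* c u" using u by blast
  qed
  moreover have "?T \<subseteq> U" using S(1) h by auto
  ultimately show ?thesis using dom by (intro exI[of _ ?T]) blast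
qed

end

subsection \<open>Contraction to a dense neighbourhood\<close>

context ugraph
begin

definition degsum :: "'v set \<Rightarrow> nat" where
  "degsum R = (\<Sum>v\<in>R. card (nb R v))"

lemma dense_minor:
  assumes "finite R" "R \<noteq> {}" "3 \<le> b" "card R < b ^ r" "b * q + 2 * r * t \<le> card R"
    and "\<And>v. v \<in> R \<Longrightarrow> card (nonnb R v) \<le> q"
  shows "cminor R t"
proof -
  have "cminor R (card ({} :: 'v set) + t)"
  proof (rule greedy_minor[where U = R and m = "b * q" and r = "2 * r"])
    show "\<exists>T\<subseteq>U'. card T \<le> 2 * r \<and> conn T \<and> (\<forall>v\<in>R. \<exists>s\<in>T. adj v s)"
      if "U' \<subseteq> R" "b * q \<le> card U'" for U'
      using dominating_connected[of R U' b q r] assms that by blast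
  qed (use assms in \<open>auto simp: is_clique_def\<close>)
  then show ?thesis by simp
qed

lemma degsum_insert:
  assumes "finite R" "v \<notin> R"
  shows "degsum (insert v R) = degsum R + 2 * card (nb R v)"
proof -
  have "card (nb (insert v R) u) = card (nb R u) + (if adj v u then 1 else 0)" if "u \<in> R" for u
  proof -
    have "nb (insert v R) u = (if adj v u then insert v (nb R u) else nb R u)"
      using adj_sym by (auto simp: nb_def)
    then show ?thesis using assms by (auto simp: nb_def)
  qed
  then have "(\<Sum>u\<in>R. card (nb (insert v R) u)) = degsum R + (\<Sum>u\<in>R. if adj v u then 1 else 0)"
    by (simp add: degsum_def sum.distrib)
  also have "(\<Sum>u\<in>R. if adj v u then 1 else 0) = card (nb R v)"
    using assms(1) by (simp add: nb_def sum.If_cases Int_def)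
  moreover have "nb (insert v R) v = nb R v" using adj_irrefl by (auto simp: nb_def)
  ultimately show ?thesis using assms by (simp add: degsum_def)
qed

text \<open>The quotient graph: its vertices are the members of a branch family.\<close>

definition qadj :: "'v set \<Rightarrow> 'v set \<Rightarrow> bool" where
  "qadj A B \<longleftrightarrow> A \<noteq> B \<and> touch A B"

lemma ugraph_qadj: "ugraph qadj"
proof
  show "qadj B A" if "qadj A B" for A B
    using that adj_sym unfolding qadj_def touch_def by blast
qed (simp add: qadj_def)

abbreviation qnb :: "'v set set \<Rightarrow> 'v set \<Rightarrow> 'v set set" where
  "qnb \<equiv> ugraph.nb qadj"

abbreviation qdegsum :: "'v set set \<Rightarrow> nat" where
  "qdegsum \<equiv> ugraph.degsum qadj"

section \<open>Minors of quotient graphs\<close>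

lemma conn_Union:
  assumes con: "ugraph.conn qadj \<A>" and each: "\<And>A. A \<in> \<A> \<Longrightarrow> conn A"
  shows "conn (\<Union>\<A>)"
proof -
  interpret Q: ugraph qadj by (rule ugraph_qadj)
  let ?U = "\<Union>\<A>"
  have inner: "(step_in ?U)\<^sup>*\<^sup>* a a'" if "A \<in> \<A>" "a \<in> A" "a' \<in> A" for A a a'
  proof -
    have "(step_in A)\<^sup>*\<^sup>* a a'" using each[OF that(1)] that unfolding conn_def by blast
    then show ?thesis by (rule rtranclp_mono[THEN predicate2D, rotated]) (use that in auto)
  qed
  have reach: "\<forall>a\<in>A. \<forall>b\<in>B. (step_in ?U)\<^sup>*\<^sup>* a b" if "(Q.step_in \<A>)\<^sup>*\<^sup>* A B" "A \<in> \<A>" for A B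
    using that
  proof (induction rule: rtranclp_induct)
    case base
    then show ?case using inner by blast
  next
    case (step B C)
    obtain b c where bc: "b \<in> B" "c \<in> C" "adj b c"
      using step(2) unfolding qadj_def touch_def by blast
    have mem: "B \<in> \<A>" "C \<in> \<A>" using step(2) by auto
    have bc': "(step_in ?U) b c" using bc mem by blast
    show ?case
    proof (intro ballI)
      fix a c' assume ac: "a \<in> A" "c' \<in> C"
      have "(step_in ?U)\<^sup>*\<^sup>* a b" using step(3)[OF step(4)] ac(1) bc(1) by blast
      then have "(step_in ?U)\<^sup>*\<^sup>* a c" using bc' by (rule rtranclp.rtrancl_into_rtrancl)
      then show "(step_in ?U)\<^sup>*\<^sup>* a c'" using inner[OF mem(2) bc(2) ac(2)] by (rule rtranclp_trans)
    qed
  qed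
  obtain A where A: "A \<in> \<A>" using con unfolding Q.conn_def by blast
  then obtain a where a: "a \<in> A" using each unfolding conn_def by blast
  show ?thesis
  proof (rule conn_from_centre[of a])
    show "a \<in> ?U" using a A by blast
    fix u assume "u \<in> ?U"
    then obtain B where "B \<in> \<A>" "u \<in> B" by blast
    then show "(step_in ?U)\<^sup>*\<^sup>* a u" using reach[of A B] A a con unfolding Q.conn_def by blast
  qed
qed

text \<open>Branch sets of the quotient are sets of branch sets, and their unions are branch sets of
  the original graph. Distinct members of \<open>P\<close> have distinct unions because these are
  disjoint and nonempty.\<close>

lemma cminor_quotient:
  assumes Q: "branch_family R Q" and minor: "ugraph.cminor qadj Q t"
  shows "cminor R t"
proof -
  interpret Q: ugraph qadj by (rule ugraph_qadj)
  obtain P where P: "Q.branch_family Q P" "card P = t" "\<forall>A\<in>P. \<forall>B\<in>P. A \<noteq> B \<longrightarrow> Q.touch A B"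
    using minor unfolding Q.cminor_def by blast
  have sub: "\<A> \<subseteq> Q" "\<A> \<noteq> {}" if "\<A> \<in> P" for \<A>
    using P(1) that unfolding Q.branch_family_def Q.conn_def by auto
  have Qd: "A \<inter> B = {}" if "A \<in> Q" "B \<in> Q" "A \<noteq> B" for A B
    using Q that unfolding branch_family_def disjoint_def by blast
  have Qn: "A \<noteq> {}" if "A \<in> Q" for A
    using Q that unfolding branch_family_def conn_def by blast
  have Pd: "\<A> \<inter> \<B> = {}" if "\<A> \<in> P" "\<B> \<in> P" "\<A> \<noteq> \<B>" for \<A> \<B>
    using P(1) that unfolding Q.branch_family_def disjoint_def by blast
  have disj: "\<Union>\<A> \<inter> \<Union>\<B> = {}" if "\<A> \<in> P" "\<B> \<in> P" "\<A> \<noteq> \<B>" for \<A> \<B>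
  proof -
    have "A \<inter> B = {}" if "A \<in> \<A>" "B \<in> \<B>" for A B
    proof (rule Qd)
      show "A \<in> Q" "B \<in> Q" using sub that \<open>\<A> \<in> P\<close> \<open>\<B> \<in> P\<close> by auto
      show "A \<noteq> B" using Pd[OF \<open>\<A> \<in> P\<close> \<open>\<B> \<in> P\<close> \<open>\<A> \<noteq> \<B>\<close>] that by auto
    qed
    then show ?thesis by blast
  qed
  have ne: "\<Union>\<A> \<noteq> {}" if "\<A> \<in> P" for \<A> using sub[OF that] Qn by blast
  have inj: "inj_on Union P" by (rule inj_onI) (metis disj ne inf.idem)
  have "branch_family R (Union ` P)" unfolding branch_family_def
  proof (intro conjI)
    show "finite (Union ` P)" using P(1) unfolding Q.branch_family_def by simp
    show "\<Union>(Union ` P) \<subseteq> R" using sub(1) Q unfolding branch_family_def by blast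
    show "\<forall>A\<in>Union ` P. conn A"
    proof
      fix A assume "A \<in> Union ` P"
      then obtain \<A> where \<A>: "\<A> \<in> P" "A = \<Union>\<A>" by blast
      show "conn A" unfolding \<A>(2)
      proof (rule conn_Union)
        show "Q.conn \<A>" using P(1) \<A>(1) unfolding Q.branch_family_def by blast
        show "conn A" if "A \<in> \<A>" for A using that sub(1)[OF \<A>(1)] Q unfolding branch_family_def by blast
      qed
    qed
    show "disjoint (Union ` P)" unfolding disjoint_def using disj by blast
  qed
  moreover have "card (Union ` P) = t" using inj P(2) by (simp add: card_image)
  moreover have "touch A B" if AB: "A \<in> Union ` P" "B \<in> Union ` P" "A \<noteq> B" for A B
  proof -
    obtain \<A> \<B> where *: "\<A> \<in> P" "\<B> \<in> P" "A = \<Union>\<A>" "B = \<Union>\<B>" using AB by blast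
    then have "Q.touch \<A> \<B>" using P(3) AB(3) by blast
    then show ?thesis unfolding Q.touch_def qadj_def touch_def * by blast
  qed
  ultimately show ?thesis unfolding cminor_def by blast
qed

section \<open>Degree sums under deletion and contraction\<close>

lemma branch_family_singletons: "finite R \<Longrightarrow> branch_family R ((\<lambda>v. {v}) ` R)"
  unfolding branch_family_def by (auto simp: disjoint_def conn_singleton)

lemma qdegsum_singletons:
  assumes "finite R"
  shows "qdegsum ((\<lambda>v. {v}) ` R) = degsum R"
proof -
  interpret Q: ugraph qadj by (rule ugraph_qadj)
  have "Q.nb ((\<lambda>v. {v}) ` R) {v} = (\<lambda>v. {v}) ` nb R v" for v
    by (auto simp: Q.nb_def nb_def qadj_def touch_def adj_irrefl)
  then show ?thesis unfolding Q.degsum_def degsum_def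
    by (simp add: sum.reindex card_image)
qed

lemma branch_family_merge:
  assumes Q: "branch_family R Q" and AB: "A \<in> Q" "B \<in> Q" "qadj A B"
  shows "branch_family R (insert (A \<union> B) (Q - {A, B}))" "A \<union> B \<notin> Q - {A, B}"
proof -
  interpret Q: ugraph qadj by (rule ugraph_qadj)
  have d: "X \<inter> Y = {}" if "X \<in> Q" "Y \<in> Q" "X \<noteq> Y" for X Y
    using Q that unfolding branch_family_def disjoint_def by blast
  have c: "conn X" if "X \<in> Q" for X using Q that unfolding branch_family_def by blast
  have "conn (\<Union>{A, B})" by (rule conn_Union) (use Q.conn_pair[OF AB(3)] AB(1,2) c in auto)
  then have "conn (A \<union> B)" by simp
  moreover have "disjoint (insert (A \<union> B) (Q - {A, B}))"
    unfolding pairwise_insert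
  proof (intro conjI allI impI)
    have "(A \<union> B) \<inter> X = {}" if "X \<in> Q - {A, B}" for X
      using d[of A X] d[of B X] that AB(1,2) by auto
    then show "disjnt (A \<union> B) X" "disjnt X (A \<union> B)" if "X \<in> Q - {A, B} \<and> X \<noteq> A \<union> B" for X
      using that unfolding disjnt_def by (auto simp: Int_commute)
    show "disjoint (Q - {A, B})" using d unfolding disjoint_def by simp
  qed
  ultimately show "branch_family R (insert (A \<union> B) (Q - {A, B}))"
    using Q AB unfolding branch_family_def by auto
  show "A \<union> B \<notin> Q - {A, B}"
  proof
    assume "A \<union> B \<in> Q - {A, B}"
    then have "(A \<union> B) \<inter> A = {}" using d[of "A \<union> B" A] AB(1) by auto
    then show False using c[OF AB(1)] unfolding conn_def by blast
  qed
qed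

text \<open>Contraction loses the edge itself and merges the two edges to each common neighbour into
  one; every lost edge counts twice.\<close>

lemma qdegsum_merge:
  assumes Q: "branch_family R Q" and AB: "A \<in> Q" "B \<in> Q" "qadj A B"
  shows "qdegsum Q = qdegsum (insert (A \<union> B) (Q - {A, B})) + 2 + 2 * card (qnb (qnb Q A) B)"
proof -
  interpret Q: ugraph qadj by (rule ugraph_qadj)
  let ?R = "Q - {A, B}"
  have fin: "finite Q" using Q unfolding branch_family_def by blast
  have neq: "A \<noteq> B" using AB(3) unfolding qadj_def by blast
  have BA: "qadj B A" using AB(3) by (rule Q.adj_sym)
  note merge = branch_family_merge[OF Q AB]
  have "Q.nb ?R (A \<union> B) = Q.nb ?R A \<union> Q.nb ?R B"
    using merge(2) unfolding Q.nb_def qadj_def touch_def by auto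
  then have un: "card (Q.nb ?R (A \<union> B)) + card (Q.nb ?R A \<inter> Q.nb ?R B) = card (Q.nb ?R A) + card (Q.nb ?R B)"
    using card_Un_Int[of "Q.nb ?R A" "Q.nb ?R B"] fin by simp
  have int: "Q.nb ?R A \<inter> Q.nb ?R B = Q.nb (Q.nb Q A) B"
    using Q.adj_irrefl unfolding Q.nb_def by auto
  have Qeq: "Q = insert A (insert B ?R)" using AB by auto
  have "Q.nb (insert B ?R) A = insert B (Q.nb ?R A)" using AB(3) unfolding Q.nb_def by auto
  then have nA: "card (Q.nb (insert B ?R) A) = card (Q.nb ?R A) + 1"
    using fin by (simp add: Q.nb_def)
  have "Q.degsum Q = Q.degsum (insert B ?R) + 2 * card (Q.nb (insert B ?R) A)"
    using Q.degsum_insert[of "insert B ?R" A] fin neq Qeq by simp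
  also have "Q.degsum (insert B ?R) = Q.degsum ?R + 2 * card (Q.nb ?R B)"
    using Q.degsum_insert[of ?R B] fin by simp
  finally have "Q.degsum Q = Q.degsum ?R + 2 * card (Q.nb ?R B) + 2 * card (Q.nb ?R A) + 2" using nA by simp
  moreover have "Q.degsum (insert (A \<union> B) ?R) = Q.degsum ?R + 2 * card (Q.nb ?R (A \<union> B))"
    using Q.degsum_insert[of ?R "A \<union> B"] fin merge(2) by simp
  ultimately show ?thesis using un int by simp
qed

text \<open>
  A quotient with fewest vertices subject to \<open>f (card Q) \<le> qdegsum Q\<close> (the degree sum counts
  every edge twice) admits neither the deletion of a vertex nor the contraction of an edge.
  Here \<open>y\<close> is the surplus of its degree sum, and \<open>H\<close> the neighbourhood of a vertex of least degree.
\<close>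

lemma contraction_neighbourhood:
  fixes f :: "nat \<Rightarrow> real"
  assumes Q0: "branch_family R Q0" "Q0 \<noteq> {}" "f (card Q0) \<le> real (qdegsum Q0)" and f1: "0 < f 1"
  obtains H n y where "branch_family R H" "2 \<le> n" "0 \<le> y" "f n + y \<le> real n * (real n - 1)"
    "real n * real (card H) \<le> f n + y" "f n - f (n - 1) + y < 2 * real (card H)"
    "\<And>B. B \<in> H \<Longrightarrow> f n - f (n - 1) + y < 2 + 2 * real (card (qnb H B))"
proof -
  interpret Q: ugraph qadj by (rule ugraph_qadj)
  define valid where "valid Q \<longleftrightarrow> branch_family R Q \<and> Q \<noteq> {} \<and> f (card Q) \<le> real (qdegsum Q)" for Q
  have "valid Q0" using Q0 unfolding valid_def by blast
  then obtain Q where Q: "valid Q" and least: "\<And>Q'. valid Q' \<Longrightarrow> card Q \<le> card Q'"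
    using ex_has_least_nat[of valid Q0 card] by blast
  have bf: "branch_family R Q" and ne: "Q \<noteq> {}" and e: "f (card Q) \<le> real (qdegsum Q)"
    using Q unfolding valid_def by auto
  have fin: "finite Q" using bf unfolding branch_family_def by blast
  define n where "n = card Q"
  define y where "y = real (qdegsum Q) - f n"
  \<comment> \<open>A single vertex has degree sum 0, which \<open>f1\<close> rules out.\<close>
  have n2: "2 \<le> n"
  proof (rule ccontr)
    assume "\<not> 2 \<le> n"
    then have "card Q = 1" using ne fin card_gt_0_iff[of Q] unfolding n_def by linarith
    then obtain A where "Q = {A}" by (metis card_1_singletonE)
    then have "qdegsum Q = 0" by (simp add: Q.degsum_def Q.nb_def Q.adj_irrefl)
    then show False using e f1 \<open>card Q = 1\<close> by simp
  qed
  have small: "real (qdegsum Q') < f (n - 1)" if "branch_family R Q'" "card Q' = n - 1" for Q'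
  proof -
    have "Q' \<noteq> {}" using that n2 by auto
    moreover have "\<not> valid Q'" using least[of Q'] that n2 unfolding n_def by auto
    ultimately show ?thesis using that unfolding valid_def by auto
  qed
  have deg_le: "card (Q.nb Q A) \<le> n - 1" if "A \<in> Q" for A
  proof -
    have "card (Q.nb Q A) \<le> card (Q - {A})" using fin Q.adj_irrefl by (intro card_mono) (auto simp: Q.nb_def)
    then show ?thesis using that fin by (simp add: n_def)
  qed
  obtain A where A: "A \<in> Q" and minA: "\<And>B. B \<in> Q \<Longrightarrow> card (Q.nb Q A) \<le> card (Q.nb Q B)"
    using ne ex_has_least_nat[of "\<lambda>A. A \<in> Q" _ "\<lambda>A. card (Q.nb Q A)"] by blast
  have "n * card (Q.nb Q A) \<le> qdegsum Q"
    using sum_mono[of Q "\<lambda>_. card (Q.nb Q A)"] minA by (simp add: Q.degsum_def n_def)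
  then have c1: "real n * real (card (Q.nb Q A)) \<le> f n + y"
    unfolding y_def by (simp flip: of_nat_mult)
  have "qdegsum Q \<le> n * (n - 1)"
    using sum_mono[of Q "\<lambda>A. card (Q.nb Q A)" "\<lambda>_. n - 1"] deg_le by (simp add: Q.degsum_def n_def)
  then have "real (qdegsum Q) \<le> real (n * (n - 1))" by (simp only: of_nat_le_iff)
  then have c2: "f n + y \<le> real n * (real n - 1)" using n2 unfolding y_def by (simp add: of_nat_diff)
  \<comment> \<open>Deleting \<open>A\<close> loses twice its degree, and by minimality the rest
    falls below \<open>f (n - 1)\<close>.\<close>
  have c3: "f n - f (n - 1) + y < 2 * real (card (Q.nb Q A))"
  proof -
    have "branch_family R (Q - {A})" by (rule branch_family_subset[OF bf]) blast
    then have "real (qdegsum (Q - {A})) < f (n - 1)" by (rule small) (use A fin in \<open>simp add: n_def\<close>)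
    moreover have "Q.nb (Q - {A}) A = Q.nb Q A" using Q.adj_irrefl by (auto simp: Q.nb_def)
    then have "qdegsum Q = qdegsum (Q - {A}) + 2 * card (Q.nb Q A)"
      using Q.degsum_insert[of "Q - {A}" A] A fin by (simp add: insert_absorb)
    ultimately show ?thesis unfolding y_def by simp
  qed
  \<comment> \<open>The same for contracting the edge from \<open>A\<close> to \<open>B\<close>,
    which loses only 2 plus twice the number of common neighbours.\<close>
  have c4: "f n - f (n - 1) + y < 2 + 2 * real (card (Q.nb (Q.nb Q A) B))" if "B \<in> Q.nb Q A" for B
  proof -
    have B: "B \<in> Q" "qadj A B" using that unfolding Q.nb_def by auto
    note merge = branch_family_merge[OF bf A B] qdegsum_merge[OF bf A B]
    have "A \<noteq> B" using B(2) unfolding qadj_def by blast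
    then have "card (insert (A \<union> B) (Q - {A, B})) = n - 1"
      using merge(2) A B(1) fin n2 by (simp add: n_def card_Diff_subset)
    then have "real (qdegsum (insert (A \<union> B) (Q - {A, B}))) < f (n - 1)" using merge(1) small by blast
    then show ?thesis using merge(3) unfolding y_def by simp
  qed
  have "branch_family R (Q.nb Q A)" by (rule branch_family_subset[OF bf]) (auto simp: Q.nb_def)
  moreover have "0 \<le> y" using e unfolding y_def n_def by simp
  ultimately show thesis using that n2 c1 c2 c3 c4 by blast
qed

text \<open>For linear \<open>f\<close> the increment is the constant \<open>2 * d\<close>. Hence
  every edge at the chosen vertex lies in more than \<open>d + y / 2 - 1\<close> triangles, whereas
  the least degree, being at most the average, is at most \<open>2 * d + y\<close>.\<close>

lemma half_dense_quotient:
  assumes fin: "finite R" "R \<noteq> {}" and d: "0 < d" and deg: "\<And>v. v \<in> R \<Longrightarrow> 2 * d \<le> card (nb R v)"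
  obtains H where "branch_family R H" "d < card H" "\<And>B. B \<in> H \<Longrightarrow> card H \<le> 2 * card (qnb H B) + 1"
proof -
  let ?Q0 = "(\<lambda>v. {v}) ` R"
  let ?f = "\<lambda>n. 2 * real d * real n"
  have "card R * (2 * d) \<le> degsum R"
    using sum_mono[of R "\<lambda>_. 2 * d" "\<lambda>v. card (nb R v)"] deg by (simp add: degsum_def)
  then have "real (card R * (2 * d)) \<le> real (degsum R)" by (simp only: of_nat_le_iff)
  then have e0: "?f (card ?Q0) \<le> real (qdegsum ?Q0)"
    using fin by (simp add: qdegsum_singletons card_image algebra_simps)
  have ne0: "?Q0 \<noteq> {}" using fin(2) by simp
  have f1: "0 < ?f 1" using d by simp
  obtain H n y where H: "branch_family R H" "2 \<le> n" "0 \<le> y" "?f n + y \<le> real n * (real n - 1)"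
    "real n * real (card H) \<le> ?f n + y" "?f n - ?f (n - 1) + y < 2 * real (card H)"
    "\<And>B. B \<in> H \<Longrightarrow> ?f n - ?f (n - 1) + y < 2 + 2 * real (card (qnb H B))"
    by (rule contraction_neighbourhood[of R ?Q0 ?f, OF branch_family_singletons[OF fin(1)] ne0 e0 f1]) blast
  have diff: "?f n - ?f (n - 1) = 2 * real d" using H(2) by (simp add: of_nat_diff algebra_simps)
  have "real n * real (card H) \<le> real n * (2 * real d + y)"
  proof -
    have "y \<le> real n * y" using H(2,3) mult_right_mono[of 1 "real n" y] by simp
    then show ?thesis using H(5) by (simp add: algebra_simps)
  qed
  then have up: "real (card H) \<le> 2 * real d + y" using H(2) by simp
  have "d < card H" using H(3,6) diff by simp
  moreover have "card H \<le> 2 * card (qnb H B) + 1" if "B \<in> H" for B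
    using H(7)[OF that] diff up by linarith
  ultimately show thesis using that H(1) by blast
qed

text \<open>For \<open>f n\<close> proportional to the power 3/2 of \<open>n\<close>, the increment
  is about 3/2 times the average \<open>f n / n\<close>. Half of the increment bounds the common
  neighbours from below, which gives 3/4 of the degree.\<close>

lemma three_quarters_dense_quotient:
  assumes H0: "branch_family R H0" "2 \<le> card H0"
    and deg: "\<And>B. B \<in> H0 \<Longrightarrow> card H0 \<le> 2 * card (qnb H0 B) + 1"
  obtains H where "branch_family R H" "3 * card H0 \<le> 64 * card H + 48"
    "\<And>B. B \<in> H \<Longrightarrow> 3 * card H \<le> 4 * card (qnb H B) + 7"
proof -
  interpret Q: ugraph qadj by (rule ugraph_qadj)
  define D where "D = card H0"
  \<comment> \<open>This \<open>w\<close> makes \<open>?f D\<close> equal to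
    \<open>D ^ 2 / 4\<close>. The degree sum of \<open>H0\<close> is at least
    \<open>D * (D - 1) / 2\<close>, which is no smaller since \<open>D\<close> is at least
    2.\<close>
  define w where "w = sqrt (real D) / 4"
  let ?f = "\<lambda>n. w * (real n * sqrt (real n))"
  have w0: "0 < w" using H0(2) unfolding w_def D_def by simp
  have wD: "16 * w\<^sup>2 = real D" unfolding w_def by (simp add: power_divide)
  have "D * (D - 1) \<le> (\<Sum>B\<in>H0. 2 * card (qnb H0 B))"
  proof -
    have "(\<Sum>B\<in>H0. D - 1) \<le> (\<Sum>B\<in>H0. 2 * card (qnb H0 B))" by (rule sum_mono) (use deg D_def in force)
    then show ?thesis by (simp add: D_def)
  qed
  also have "\<dots> = 2 * qdegsum H0" by (simp add: Q.degsum_def sum_distrib_left)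
  finally have "real (D * (D - 1)) \<le> real (2 * qdegsum H0)" by (simp only: of_nat_le_iff)
  then have e: "real D * (real D - 1) \<le> 2 * real (qdegsum H0)" using H0(2) by (simp add: D_def of_nat_diff)
  have "?f D = (real D)\<^sup>2 / 4" unfolding w_def by (simp add: power2_eq_square)
  also have "\<dots> \<le> real (qdegsum H0)"
  proof -
    have "real D * 2 \<le> real D * real D" using H0(2) by (intro mult_left_mono) (auto simp: D_def)
    then show ?thesis using e by (simp add: power2_eq_square algebra_simps)
  qed
  finally have e0: "?f (card H0) \<le> real (qdegsum H0)" unfolding D_def .
  have ne0: "H0 \<noteq> {}" using H0(2) by auto
  have f1: "0 < ?f 1" using w0 by simp
  obtain H n y where H: "branch_family R H" "2 \<le> n" "0 \<le> y" "?f n + y \<le> real n * (real n - 1)"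
    "real n * real (card H) \<le> ?f n + y" "?f n - ?f (n - 1) + y < 2 * real (card H)"
    "\<And>B. B \<in> H \<Longrightarrow> ?f n - ?f (n - 1) + y < 2 + 2 * real (card (qnb H B))"
    by (rule contraction_neighbourhood[of R H0 ?f, OF H0(1) ne0 e0 f1]) blast
  define s where "s = sqrt (real n)"
  define u where "u = sqrt (real (n - 1))"
  have s2: "s * s = real n" and u2: "u * u = real n - 1" using H(2) by (simp_all add: s_def u_def of_nat_diff)
  have s1: "1 \<le> s" and u0: "1 \<le> u" and us: "u \<le> s" using H(2) by (simp_all add: s_def u_def)
  have fn: "?f n = w * (s * s * s)" using s2 by (simp add: s_def)
  have fn1: "?f (n - 1) = w * (u * u * u)" using u2 H(2) by (simp add: u_def of_nat_diff)
  \<comment> \<open>A simple graph has degree sum at most \<open>n * (n - 1)\<close>. The resulting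
    bound on \<open>w\<close> serves both the error term in \<open>diff\<close> and the size of
    \<open>H\<close>.\<close>
  have ws: "w \<le> s"
  proof -
    have "w * (s * s * s) \<le> (s * s) * (s * s)" using H(3,4) fn s2 by (simp add: algebra_simps)
    then have "(s * s * s) * w \<le> (s * s * s) * s" by (simp add: ac_simps)
    then show ?thesis using s1 by (subst (asm) mult_le_cancel_left_pos) auto
  qed
  \<comment> \<open>A discrete derivative: \<open>s * s - u * u = 1\<close> gives
    \<open>s ^ 3 - u ^ 3 \<ge> 3 / 2 * u\<close>, by the nonnegative term
    \<open>(s - u) ^ 2 * (2 * s + u)\<close>; replacing \<open>w * u\<close> by \<open>w * s\<close>
    costs at most 1.\<close>
  have diff: "3 / 2 * w * s - 3 / 2 \<le> ?f n - ?f (n - 1)"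
  proof -
    have d1: "(s - u) * (s + u) = 1" using s2 u2 by (simp add: algebra_simps)
    have "3 * u * ((s - u) * (s + u)) \<le> 2 * ((s - u) * (s * s + s * u + u * u))"
    proof -
      have "0 \<le> (s - u) * ((s - u) * (2 * s + u))" using us u0 by (intro mult_nonneg_nonneg) auto
      then show ?thesis by (simp add: algebra_simps)
    qed
    moreover have "(s - u) * (s * s + s * u + u * u) = s * s * s - u * u * u" by (simp add: algebra_simps)
    ultimately have d2: "3 / 2 * u \<le> s * s * s - u * u * u" using d1 by simp
    have "(s - u) * s \<le> (s - u) * (s + u)" using us u0 by (intro mult_left_mono) auto
    then have "(s - u) * s \<le> 1" using d1 by simp
    moreover have "w * (s - u) \<le> s * (s - u)" using ws us by (intro mult_right_mono) auto
    ultimately have d3: "w * s - 1 \<le> w * u" by (simp add: algebra_simps)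
    have "w * (3 / 2 * u) \<le> w * (s * s * s - u * u * u)" using d2 w0 by (intro mult_left_mono) auto
    then show ?thesis using d3 unfolding fn fn1 by (simp add: algebra_simps)
  qed
  have up: "real (card H) \<le> w * s + y / 2"
  proof -
    have "y * 2 \<le> y * real n" using H(2,3) by (intro mult_left_mono) auto
    then have "real n * real (card H) \<le> real n * (w * s + y / 2)"
    proof -
      have "real n * (w * s + y / 2) = w * (s * s * s) + y * real n / 2"
        unfolding s2[symmetric] by (simp add: algebra_simps)
      then show ?thesis using H(5) \<open>y * 2 \<le> y * real n\<close> unfolding fn by linarith
    qed
    then show ?thesis using H(2) by simp
  qed
  have "3 * card H0 \<le> 64 * card H + 48"
  proof -
    have "w * w \<le> w * s" using ws w0 by (intro mult_left_mono) auto
    then have "real D \<le> 16 * (w * s)" using wD by (simp add: power2_eq_square)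
    then have "3 * real D \<le> 64 * real (card H) + 48" using H(3,6) diff by (simp add: algebra_simps)
    then show ?thesis unfolding D_def by linarith
  qed
  moreover have "3 * card H \<le> 4 * card (qnb H B) + 7" if "B \<in> H" for B
  proof -
    have "3 * real (card H) \<le> 4 * real (card (qnb H B)) + 7" using H(7)[OF that] H(3) diff up by (simp add: algebra_simps)
    then show ?thesis by linarith
  qed
  ultimately show thesis using that H(1) by blast
qed

lemma dense_quotient:
  assumes "finite R" "R \<noteq> {}" "2 \<le> d" "\<And>v. v \<in> R \<Longrightarrow> 2 * d \<le> card (nb R v)"
  obtains H where "branch_family R H" "3 * d \<le> 64 * card H + 48"
    "\<And>B. B \<in> H \<Longrightarrow> 3 * card H \<le> 4 * card (qnb H B) + 7"
proof -
  have "0 < d" using assms(3) by simp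
  then obtain H0 where H0: "branch_family R H0" "d < card H0"
    "\<And>B. B \<in> H0 \<Longrightarrow> card H0 \<le> 2 * card (qnb H0 B) + 1"
    using half_dense_quotient[OF assms(1,2) _ assms(4)] by blast
  then have "2 \<le> card H0" using assms(3) by linarith
  then obtain H where H: "branch_family R H" "3 * card H0 \<le> 64 * card H + 48"
    "\<And>B. B \<in> H \<Longrightarrow> 3 * card H \<le> 4 * card (qnb H B) + 7"
    using three_quarters_dense_quotient[OF H0(1) _ H0(3)] by blast
  then show thesis using that H0(2) by fastforce
qed

text \<open>The contracted neighbourhood \<open>H\<close> has at least \<open>t ^ 2\<close>
  vertices, each missing only about a quarter of them, so \<open>dense_minor\<close> applies in the
  quotient with \<open>b = 3\<close>.\<close>

lemma min_degree_minor:
  assumes fin: "finite R" "R \<noteq> {}"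
    and large: "\<And>D. t ^ 2 \<le> D \<Longrightarrow> \<exists>r. D < 3 ^ r \<and> 8 * r * t + 21 \<le> D" and t: "100 \<le> t"
    and deg: "\<And>v. v \<in> R \<Longrightarrow> t ^ 3 \<le> card (nb R v)"
  shows "cminor R t"
proof -
  interpret Q: ugraph qadj by (rule ugraph_qadj)
  have t3: "t ^ 3 = t * t ^ 2" by (simp add: power3_eq_cube power2_eq_square)
  have sq: "100 * 100 \<le> t ^ 2" using mult_le_mono[OF t t] by (simp add: power2_eq_square)
  define d where "d = t ^ 3 div 2"
  have "100 * t ^ 2 \<le> t ^ 3" using t t3 by simp
  then have big: "100 * t ^ 2 \<le> 2 * d + 1" unfolding d_def by linarith
  then have d2: "2 \<le> d" using sq by linarith
  have dd: "2 * d \<le> card (nb R v)" if "v \<in> R" for v using deg[OF that] unfolding d_def by linarith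
  obtain H where H: "branch_family R H" "3 * d \<le> 64 * card H + 48"
    "\<And>B. B \<in> H \<Longrightarrow> 3 * card H \<le> 4 * card (qnb H B) + 7"
    using dense_quotient[OF fin d2 dd] by blast
  have "t ^ 2 \<le> card H" using H(2) big sq by linarith
  then obtain r where r: "card H < 3 ^ r" "8 * r * t + 21 \<le> card H" using large by blast
  have finH: "finite H" using H(1) unfolding branch_family_def by blast
  have "H \<noteq> {}" using r by auto
  have "Q.cminor H t"
  proof (rule Q.dense_minor[OF finH \<open>H \<noteq> {}\<close> le_refl r(1)])
    \<comment> \<open>Multiplying by 4 shows where \<open>8 * r * t + 21\<close> comes from.\<close>
    show "3 * ((card H + 7) div 4) + 2 * r * t \<le> card H" using r(2) by linarith
    show "card (Q.nonnb H B) \<le> (card H + 7) div 4" if "B \<in> H" for B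
      using H(3)[OF that] Q.card_nb_nonnb[OF finH, of B] by linarith
  qed
  then show ?thesis using cminor_quotient[OF H(1)] by blast
qed

end

subsection \<open>Counting cliques\<close>

text \<open>The number of \<open>k\<close>-cliques of the complete multipartite graph with part sizes \<open>M\<close>.\<close>

definition es :: "nat multiset \<Rightarrow> nat \<Rightarrow> nat" where
  "es M k = coeff (\<Prod>x\<in>#M. [:1, x:]) k"

lemma es_empty: "es {#} k = (if k = 0 then 1 else 0)"
  by (cases k) (auto simp: es_def)

lemma es_0 [simp]: "es M 0 = 1"
  by (induction M) (auto simp: es_def coeff_mult_0)

lemma es_add_Suc: "es (add_mset x M) (Suc k) = es M (Suc k) + x * es M k"
  by (simp add: es_def)

lemma es_eq_0: "size M < k \<Longrightarrow> es M k = 0"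
proof (induction M arbitrary: k)
  case empty
  then show ?case by (simp add: es_empty)
next
  case (add x M)
  then show ?case by (cases k) (auto simp: es_add_Suc)
qed

context ugraph
begin

section \<open>Recursions for clique counts and Zykov's theorem\<close>

definition ncl :: "'v set \<Rightarrow> nat \<Rightarrow> nat" where
  "ncl R j = card {C. C \<subseteq> R \<and> card C = j \<and> is_clique C}"

lemma finite_cliques [simp]: "finite R \<Longrightarrow> finite {C. C \<subseteq> R \<and> P C}"
  by (rule finite_subset[of _ "Pow R"]) auto

lemma ncl_0:
  assumes "finite R"
  shows "ncl R 0 = 1"
proof -
  have "{C. C \<subseteq> R \<and> card C = 0 \<and> is_clique C} = {{}}"
    using finite_subset[OF _ assms] by (auto simp: is_clique_def)
  then show ?thesis by (simp add: ncl_def)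
qed

lemma ncl_mono: "finite S \<Longrightarrow> R \<subseteq> S \<Longrightarrow> ncl R j \<le> ncl S j"
  unfolding ncl_def by (intro card_mono) auto

lemma ncl_eq_0:
  assumes "\<And>C. C \<subseteq> R \<Longrightarrow> is_clique C \<Longrightarrow> card C \<le> r" "r < j"
  shows "ncl R j = 0"
proof -
  have none: "\<not> (C \<subseteq> R \<and> card C = j \<and> is_clique C)" for C using assms(1)[of C] assms(2) by auto
  show ?thesis unfolding ncl_def by (simp add: none)
qed

lemma ncl_empty: "ncl {} j = (if j = 0 then 1 else 0)"
  using ncl_0[of "{}"] ncl_eq_0[of "{}" 0 j] by auto

lemma ncl_insert:
  assumes fin: "finite R" and v: "v \<notin> R"
  shows "ncl (insert v R) (Suc j) = ncl R (Suc j) + ncl (nb R v) j"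
proof -
  let ?A = "{C. C \<subseteq> R \<and> card C = Suc j \<and> is_clique C}"
  let ?B = "{C. C \<subseteq> nb R v \<and> card C = j \<and> is_clique C}"
  have vB: "v \<notin> C" "finite C" if "C \<subseteq> nb R v" for C
    using that v fin finite_subset[of C R] by (auto simp: nb_def)
  have "{C. C \<subseteq> insert v R \<and> card C = Suc j \<and> is_clique C} = ?A \<union> insert v ` ?B" (is "?L = _")
  proof (intro equalityI subsetI)
    fix C assume C: "C \<in> ?L"
    show "C \<in> ?A \<union> insert v ` ?B"
    proof (cases "v \<in> C")
      case True
      have "C - {v} \<in> ?B" using C True v unfolding is_clique_def nb_def by auto
      moreover have "C = insert v (C - {v})" using True by blast
      ultimately show ?thesis by blast
    qed (use C in auto)
  next
    fix C assume C: "C \<in> ?A \<union> insert v ` ?B"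
    show "C \<in> ?L"
    proof (cases "C \<in> ?A")
      case False
      then obtain D where D: "D \<in> ?B" "C = insert v D" using C by blast
      then show ?thesis using vB[of D] adj_sym by (auto simp: is_clique_def nb_def)
    qed auto
  qed
  moreover have "?A \<inter> insert v ` ?B = {}" using v by auto
  moreover have "inj_on (insert v) ?B"
  proof (rule inj_onI)
    fix C D assume "C \<in> ?B" "D \<in> ?B" "insert v C = insert v D"
    then show "C = D" using vB(1)[of C] vB(1)[of D] by (metis (mono_tags, lifting) insert_ident mem_Collect_eq)
  qed
  ultimately show ?thesis using fin unfolding ncl_def
    by (simp add: card_Un_disjoint card_image)
qed

lemma ncl_remove:
  assumes "finite R" "v \<in> R"
  shows "ncl R (Suc j) = ncl (R - {v}) (Suc j) + ncl (nb R v) j"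
proof -
  have "nb (R - {v}) v = nb R v" using adj_irrefl by (auto simp: nb_def)
  then show ?thesis using ncl_insert[of "R - {v}" v j] assms by (simp add: insert_absorb)
qed

text \<open>Deleting the vertices of \<open>Z\<close> one at a time charges each clique meeting
  \<open>Z\<close> to its first deleted vertex. The sum may overcount, as neighbourhoods are taken
  in all of \<open>R\<close>.\<close>

lemma ncl_split:
  assumes fin: "finite R" and Z: "Z \<subseteq> R"
  shows "ncl R (Suc i) \<le> ncl (R - Z) (Suc i) + (\<Sum>u\<in>Z. ncl (nb R u) i)"
proof -
  have "finite Z" using fin Z finite_subset by blast
  then show ?thesis using Z
  proof (induction Z rule: finite_induct)
    case (insert u Z)
    have "ncl (R - Z) (Suc i) = ncl (R - insert u Z) (Suc i) + ncl (nb (R - Z) u) i"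
      using ncl_remove[of "R - Z" u i] insert fin by (simp add: Diff_insert2[symmetric] Diff_insert[symmetric])
    moreover have "ncl (nb (R - Z) u) i \<le> ncl (nb R u) i" using fin by (intro ncl_mono) (auto simp: nb_def)
    ultimately show ?case using insert by simp
  qed simp
qed

text \<open>
  Zykov's theorem. The weights \<open>w\<close> make the induction on the clique number work: the
  non-neighbours of the vertex lying in the largest weighted number of cliques become a part.
\<close>

lemma weighted_Zykov:
  assumes "finite R" "\<And>C. C \<subseteq> R \<Longrightarrow> is_clique C \<Longrightarrow> card C \<le> r"
  shows "\<exists>M. size M = r \<and> sum_mset M = card R \<and> (\<Sum>i\<le>r. w i * ncl R i) \<le> (\<Sum>i\<le>r. w i * es M i)"
  using assms
proof (induction r arbitrary: R w)
  case 0
  have "R = {}"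
  proof (rule ccontr)
    assume "R \<noteq> {}"
    then obtain v where "v \<in> R" by blast
    then have "card {v} \<le> 0" using 0(2)[of "{v}"] by (auto simp: is_clique_def)
    then show False by simp
  qed
  then show ?case by (intro exI[of _ "{#}"]) (auto simp: ncl_empty)
next
  case (Suc r)
  show ?case
  proof (cases "R = {}")
    case True
    have "ncl R i \<le> es (replicate_mset (Suc r) 0) i" for i using True by (auto simp: ncl_empty)
    then show ?thesis using True
      by (intro exI[of _ "replicate_mset (Suc r) 0"] conjI sum_mono mult_le_mono2) auto
  next
    case False
    \<comment> \<open>The weighted number of cliques through \<open>v\<close>: an
      \<open>i\<close>-clique of neighbours becomes, with \<open>v\<close>, a clique of weight
      \<open>w (Suc i)\<close>.\<close>
    define c where "c v = (\<Sum>i\<le>r. w (Suc i) * ncl (nb R v) i)" for v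
    have "Max (c ` R) \<in> c ` R" using Suc.prems(1) False by (intro Max_in) auto
    then obtain v where v: "v \<in> R" "c v = Max (c ` R)" by force
    have cmax: "c u \<le> c v" if "u \<in> R" for u using that Suc.prems(1) v(2) by simp
    let ?A = "nb R v" and ?Z = "nonnb R v"
    define z where "z = card ?Z"
    have RZ: "R - ?Z = ?A" by (auto simp: nb_def nonnb_def)
    have sizes: "card ?A + z = card R" unfolding z_def by (rule card_nb_nonnb[OF Suc.prems(1)])
    have finA: "finite ?A" using Suc.prems(1) by simp
    have small: "card C \<le> r" if "C \<subseteq> ?A" "is_clique C" for C
    proof -
      have "v \<notin> C" "finite C" using that(1) adj_irrefl finite_subset[OF _ finA] by (auto simp: nb_def)
      moreover have "is_clique (insert v C)"
        using that adj_sym unfolding is_clique_def nb_def by blast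
      moreover have "insert v C \<subseteq> R" using v(1) that(1) by (auto simp: nb_def)
      ultimately show ?thesis using Suc.prems(2)[of "insert v C"] by simp
    qed
    \<comment> \<open>The new weights count an \<open>i\<close>-clique of \<open>?A\<close> once by
      itself and once with each of the \<open>z\<close> vertices of the new part.\<close>
    obtain M where M: "size M = r" "sum_mset M = card ?A"
      "(\<Sum>i\<le>r. (w i + z * w (Suc i)) * ncl ?A i) \<le> (\<Sum>i\<le>r. (w i + z * w (Suc i)) * es M i)"
      using Suc.IH[OF finA small, of "\<lambda>i. w i + z * w (Suc i)"] by blast
    have shift: "(\<Sum>i\<le>Suc r. w i * g i) = w 0 * g 0 + (\<Sum>i\<le>r. w (Suc i) * g (Suc i))" for g :: "nat \<Rightarrow> nat"
      by (rule sum.atMost_Suc_shift)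
    have "(\<Sum>i\<le>Suc r. w i * ncl R i) = w 0 + (\<Sum>i\<le>r. w (Suc i) * ncl R (Suc i))"
      using Suc.prems(1) by (simp only: shift ncl_0 mult_1_right)
    also have "\<dots> \<le> w 0 + (\<Sum>i\<le>r. w (Suc i) * (ncl ?A (Suc i) + (\<Sum>u\<in>?Z. ncl (nb R u) i)))"
      using ncl_split[of R ?Z] Suc.prems(1) RZ
      by (intro add_left_mono sum_mono mult_le_mono2) (auto simp: nonnb_def)
    also have "\<dots> = (\<Sum>i\<le>Suc r. w i * ncl ?A i) + (\<Sum>i\<le>r. w (Suc i) * (\<Sum>u\<in>?Z. ncl (nb R u) i))"
      by (simp only: shift ncl_0[OF finA] add_mult_distrib2 sum.distrib mult_1_right add.assoc)
    also have "(\<Sum>i\<le>r. w (Suc i) * (\<Sum>u\<in>?Z. ncl (nb R u) i)) = (\<Sum>u\<in>?Z. c u)"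
      unfolding c_def sum_distrib_left by (rule sum.swap)
    also have "\<dots> \<le> z * c v" unfolding z_def
      using sum_bounded_above[of ?Z c "c v"] cmax by (auto simp: nonnb_def)
    also have "(\<Sum>i\<le>Suc r. w i * ncl ?A i) = (\<Sum>i\<le>r. w i * ncl ?A i)"
      using ncl_eq_0[OF small] by simp
    also have "(\<Sum>i\<le>r. w i * ncl ?A i) + z * c v = (\<Sum>i\<le>r. (w i + z * w (Suc i)) * ncl ?A i)"
      unfolding c_def by (simp only: sum_distrib_left add_mult_distrib sum.distrib mult.assoc)
    also note M(3)
    also have "(\<Sum>i\<le>r. (w i + z * w (Suc i)) * es M i) = (\<Sum>i\<le>r. w i * es M i) + z * (\<Sum>i\<le>r. w (Suc i) * es M i)"
      by (simp only: sum_distrib_left add_mult_distrib sum.distrib mult.assoc)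
    also have "(\<Sum>i\<le>r. w i * es M i) = (\<Sum>i\<le>Suc r. w i * es M i)" using M(1) by (simp add: es_eq_0)
    also have "(\<Sum>i\<le>Suc r. w i * es M i) + z * (\<Sum>i\<le>r. w (Suc i) * es M i) = (\<Sum>i\<le>Suc r. w i * es (add_mset z M) i)"
      by (simp only: shift es_0 es_add_Suc add_mult_distrib2 sum.distrib sum_distrib_left)
        (simp add: ac_simps)
    finally have "(\<Sum>i\<le>Suc r. w i * ncl R i) \<le> (\<Sum>i\<le>Suc r. w i * es (add_mset z M) i)" by simp
    then show ?thesis using M(1,2) sizes by (intro exI[of _ "add_mset z M"]) simp
  qed
qed

text \<open>All weight is put on \<open>j\<close>; above \<open>r\<close> there are no cliques to
  count.\<close>

corollary Zykov:
  assumes "finite R" "\<And>C. C \<subseteq> R \<Longrightarrow> is_clique C \<Longrightarrow> card C \<le> r"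
  obtains M where "size M = r" "sum_mset M = card R" "ncl R j \<le> es M j"
proof -
  obtain M where M: "size M = r" "sum_mset M = card R"
    "(\<Sum>i\<le>r. (if i = j then 1 else 0) * ncl R i) \<le> (\<Sum>i\<le>r. (if i = j then 1 else 0) * es M i)"
    using weighted_Zykov[OF assms, of "\<lambda>i. if i = j then 1 else 0"] by blast
  have "ncl R j \<le> es M j"
  proof (cases "j \<le> r")
    case True
    have "(\<Sum>i\<le>r. (if i = j then 1 else 0) * g i) = g j" for g :: "nat \<Rightarrow> nat"
      using True by (simp add: if_distrib[of "\<lambda>x. x * _"] cong: if_cong)
    then show ?thesis using M(3) by simp
  next
    case False
    have "ncl R j = 0" by (rule ncl_eq_0[OF assms(2)]) (use False in auto)
    then show ?thesis by simp
  qed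
  then show thesis using that M by blast
qed

text \<open>
  A clique is located by deciding, for one vertex \<open>v\<close> after another, whether it contains \<open>v\<close>;
  each positive answer lowers the potential \<open>\<phi>\<close> by at least one.
\<close>

lemma peeling:
  fixes \<phi> :: "'v set \<Rightarrow> real"
  assumes fin: "finite R\<^sub>0" and M: "0 < M"
    and mono: "\<And>R v. R \<subseteq> R\<^sub>0 \<Longrightarrow> v \<in> R \<Longrightarrow> \<phi> (R - {v}) \<le> \<phi> R"
    and nonneg: "\<And>R. R \<subseteq> R\<^sub>0 \<Longrightarrow> 0 \<le> \<phi> R"
    and step: "\<And>R. R \<subseteq> R\<^sub>0 \<Longrightarrow> \<not> stop R \<Longrightarrow> \<exists>v\<in>R. \<phi> (nb R v) + 1 \<le> \<phi> R"
    and leaf: "\<And>R i. R \<subseteq> R\<^sub>0 \<Longrightarrow> stop R \<Longrightarrow> i \<le> j \<Longrightarrow> j \<le> i + n \<Longrightarrow> ncl R i \<le> M"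
    and n: "\<phi> R\<^sub>0 \<le> real n"
  shows "ncl R\<^sub>0 j \<le> (card R\<^sub>0 + 1) ^ n * M"
proof -
  \<comment> \<open>The last assumption says that the \<open>j - i\<close> positive answers so far
    are at most the spent part \<open>n - m\<close> of the budget; this yields the range of
    \<open>i\<close> in \<open>leaf\<close>.\<close>
  have "ncl R i \<le> (card R + 1) ^ m * M"
    if "R \<subseteq> R\<^sub>0" "\<phi> R \<le> real m" "i \<le> j" "j + m \<le> i + n" for R i m
    using that
  proof (induction "card R" arbitrary: R i m rule: less_induct)
    case less
    have finR: "finite R" using less.prems(1) fin finite_subset by blast
    show ?case
    proof (cases "stop R \<or> i = 0")
      case True
      then have "ncl R i \<le> M" using leaf[of R i] less.prems ncl_0[OF finR] M by fastforce
      also have "\<dots> \<le> (card R + 1) ^ m * M" by simp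
      finally show ?thesis .
    next
      case False
      then obtain v where v: "v \<in> R" "\<phi> (nb R v) + 1 \<le> \<phi> R" using step less.prems(1) by blast
      obtain i' where i': "i = Suc i'" using False by (metis not0_implies_Suc)
      have sub: "nb R v \<subseteq> R - {v}" using adj_irrefl by (auto simp: nb_def)
      have "0 \<le> \<phi> (nb R v)" using sub less.prems(1) by (intro nonneg) auto
      then have "m \<noteq> 0" using v(2) less.prems(2) by (intro notI) simp
      then obtain m' where m': "m = Suc m'" by (metis not0_implies_Suc)
      have cR: "card (R - {v}) + 1 = card R" using card_Suc_Diff1[OF finR v(1)] by simp
      have cN: "card (nb R v) + 1 \<le> card R" using card_mono[OF _ sub] finR cR by simp
      have a: "ncl (R - {v}) i \<le> (card (R - {v}) + 1) ^ m * M"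
        using less.prems mono[OF less.prems(1) v(1)] cR by (intro less.hyps) auto
      have "ncl (nb R v) i' \<le> (card (nb R v) + 1) ^ m' * M"
        using less.prems v(2) sub cN i' m' by (intro less.hyps) auto
      also have "\<dots> \<le> card R ^ m' * M" using cN by (intro mult_le_mono1 power_mono) auto
      finally have "ncl R i \<le> card R ^ m * M + card R ^ m' * M"
        using ncl_remove[OF finR v(1), of i'] a i' cR by simp
      \<comment> \<open>The two branches add up to
        \<open>x ^ m + x ^ (m - 1) = (x + 1) * x ^ (m - 1)\<close> for \<open>x = card R\<close>,
        hence the base \<open>card R + 1\<close>.\<close>
      also have "\<dots> = (card R + 1) * card R ^ m' * M" unfolding m' by (simp add: algebra_simps)
      also have "\<dots> \<le> (card R + 1) * (card R + 1) ^ m' * M"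
        by (intro mult_le_mono power_mono) auto
      finally show ?thesis unfolding m' by simp
    qed
  qed
  from this[of R\<^sub>0 n j] show ?thesis using n by simp
qed

text \<open>Repeatedly remove a vertex with fewer than \<open>D\<close> remaining neighbours. Each
  clique is charged to its first removed vertex; its other \<open>j\<close> vertices lie among those
  neighbours.\<close>

lemma degenerate_count:
  assumes "finite V"
    and "\<And>R. R \<subseteq> V \<Longrightarrow> R \<noteq> {} \<Longrightarrow> \<exists>v\<in>R. card (nb R v) < D"
    and "\<And>R. R \<subseteq> V \<Longrightarrow> card R < D \<Longrightarrow> ncl R j \<le> M"
  shows "ncl V (Suc j) \<le> card V * M"
  using assms
proof (induction "card V" arbitrary: V)
  case 0
  then show ?case by (simp add: ncl_empty)
next
  case (Suc n)
  then have "V \<noteq> {}" by auto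
  then obtain v where v: "v \<in> V" "card (nb V v) < D" using Suc.prems(2) by blast
  have c: "n = card (V - {v})" using Suc v by simp
  have "ncl (V - {v}) (Suc j) \<le> card (V - {v}) * M"
  proof (rule Suc.hyps(1)[OF c])
    show "\<exists>v\<in>R. card (nb R v) < D" if "R \<subseteq> V - {v}" "R \<noteq> {}" for R
      using Suc.prems(2)[of R] that by blast
    show "ncl R j \<le> M" if "R \<subseteq> V - {v}" "card R < D" for R
      using Suc.prems(3)[of R] that by blast
  qed (use Suc.prems(1) in simp)
  moreover have "ncl (nb V v) j \<le> M" using v(2) by (intro Suc.prems(3)) (auto simp: nb_def)
  ultimately show ?case using ncl_remove[OF Suc.prems(1) v(1), of j] c Suc.hyps(2)
    by (metis Suc_eq_plus1 add_mono mult_Suc add.commute Suc_eq_plus1_left)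
qed

text \<open>While at least \<open>4 * r * t\<close> vertices remain, \<open>dense_minor\<close>
  forces a vertex that misses a fraction \<open>1 / (2 * b)\<close> of them. Choosing it multiplies
  the size by at most \<open>1 - 1 / (2 * b)\<close>, so \<open>2 * b\<close> times the logarithm
  drops by 1.\<close>

lemma peel_sparse:
  assumes fin: "finite R\<^sub>0" and free: "\<not> cminor R\<^sub>0 t" and b: "3 \<le> b" and r: "card R\<^sub>0 < b ^ r" and r0: "0 < r"
    and n: "2 * real b * ln (real (card R\<^sub>0)) \<le> real n" and M: "0 < M"
    and leaf: "\<And>R i. R \<subseteq> R\<^sub>0 \<Longrightarrow> card R < 4 * r * t \<Longrightarrow> i \<le> j \<Longrightarrow> j \<le> i + n \<Longrightarrow> ncl R i \<le> M"
  shows "ncl R\<^sub>0 j \<le> (card R\<^sub>0 + 1) ^ n * M"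
proof (rule peeling[where \<phi> = "\<lambda>R. 2 * real b * ln (real (card R))" and stop = "\<lambda>R. card R < 4 * r * t"])
  have ln_mono: "ln (real x) \<le> ln (real y)" if "x \<le> y" for x y :: nat
    using that by (cases "x = 0"; cases "y = 0") (auto intro: ln_ge_zero)
  show "2 * real b * ln (real (card (R - {v}))) \<le> 2 * real b * ln (real (card R))" if "v \<in> R" for R v
    using ln_mono[OF card_Diff1_le[of R v]] by (simp add: mult_left_mono)
  show "0 \<le> 2 * real b * ln (real (card R))" for R :: "'v set" using ln_mono[of 0 "card R"] by simp
  show "\<exists>v\<in>R. 2 * real b * ln (real (card (nb R v))) + 1 \<le> 2 * real b * ln (real (card R))"
    if R: "R \<subseteq> R\<^sub>0" "\<not> card R < 4 * r * t" for R
  proof -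
    define m where "m = card R"
    have finR: "finite R" using R(1) fin finite_subset by blast
    have notminor: "\<not> cminor R t" using cminor_mono[OF _ R(1)] free by blast
    then have t0: "0 < t" using cminor_antimono[of R _ 0] clique_minor[of R "{}"] finR
      by (cases t) (auto simp: is_clique_def)
    have mt: "4 * (r * t) \<le> m" using R(2) by (simp add: m_def)
    have m4: "4 \<le> m"
    proof -
      have "1 * 1 \<le> r * t" using r0 t0 by (intro mult_le_mono) auto
      then show ?thesis using mt by linarith
    qed
    have ne: "R \<noteq> {}" using m4 unfolding m_def by auto
    \<comment> \<open>Half of the \<open>m\<close> vertices pays for \<open>b * q\<close>, the other
      half for \<open>2 * r * t\<close>.\<close>
    define q where "q = m div (2 * b)"
    have q2: "2 * b * q \<le> m" unfolding q_def by simp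
    have mr: "card R < b ^ r" using r card_mono[OF fin R(1)] by simp
    have "\<exists>v\<in>R. q < card (nonnb R v)"
    proof (rule ccontr)
      assume "\<not> ?thesis"
      then have "card (nonnb R v) \<le> q" if "v \<in> R" for v using that by force
      moreover have "b * q + 2 * r * t \<le> card R" using q2 mt by (simp add: m_def)
      ultimately have "cminor R t" by (intro dense_minor[OF finR ne b mr])
      then show False using notminor by blast
    qed
    then obtain v where v: "v \<in> R" "q < card (nonnb R v)" by blast
    have "m < (q + 1) * (2 * b)" unfolding q_def using b by (simp add: dividend_less_div_times)
    also have "\<dots> \<le> card (nonnb R v) * (2 * b)" using v(2) by (intro mult_le_mono1) simp
    finally have "real m \<le> real (card (nonnb R v) * (2 * b))" by (simp only: of_nat_le_iff)
    then have "real m / (2 * real b) \<le> real (card (nonnb R v))" using b by (simp add: field_simps)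
    then have drop: "real (card (nb R v)) \<le> real m * (1 - 1 / (2 * real b))"
    proof -
      have "real (card (nb R v)) + real (card (nonnb R v)) = real m"
        using card_nb_nonnb[OF finR, of v] unfolding m_def by (simp flip: of_nat_add)
      moreover have "real m * (1 - 1 / (2 * real b)) = real m - real m / (2 * real b)" by (simp add: algebra_simps)
      ultimately show ?thesis using \<open>real m / (2 * real b) \<le> real (card (nonnb R v))\<close> by linarith
    qed
    have "2 * real b * ln (real (card (nb R v))) + 1 \<le> 2 * real b * ln (real m)"
    proof (cases "card (nb R v) = 0")
      \<comment> \<open>Here \<open>ln 0\<close> is 0 by convention, so the drop must come from
        \<open>ln m\<close> itself; \<open>m \<ge> 4\<close> suffices.\<close>
      case True
      have "ln (1 / real m) \<le> 1 / real m - 1" using m4 by (intro ln_le_minus_one) simp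
      also have "1 / real m \<le> 1 / 4" using m4 by (intro divide_left_mono) auto
      finally have "3 / 4 \<le> ln (real m)" using m4 by (simp add: ln_div)
      then have "6 * (3 / 4) \<le> 2 * real b * ln (real m)" using b by (intro mult_mono) auto
      then show ?thesis using True by simp
    next
      case False
      have pos: "0 < 1 - 1 / (2 * real b)" using b by simp
      have "ln (real (card (nb R v))) \<le> ln (real m * (1 - 1 / (2 * real b)))"
        using drop False m4 pos by (subst ln_le_cancel_iff) auto
      also have "\<dots> = ln (real m) + ln (1 - 1 / (2 * real b))" using m4 pos by (simp add: ln_mult)
      also have "ln (1 - 1 / (2 * real b)) \<le> (1 - 1 / (2 * real b)) - 1" using pos by (rule ln_le_minus_one)
      finally have "2 * real b * ln (real (card (nb R v))) \<le> 2 * real b * (ln (real m) - 1 / (2 * real b))"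
        using b by (intro mult_left_mono) auto
      then show ?thesis using b by (simp add: algebra_simps)
    qed
    then show ?thesis using v(1) unfolding m_def by blast
  qed
qed (use fin M n leaf in auto)

section \<open>The clique number and the excess over \<open>2 * t\<close>\<close>

definition omega :: "'v set \<Rightarrow> nat" where
  "omega R = Max (card ` {C. C \<subseteq> R \<and> is_clique C})"

lemma omega_ge: "finite R \<Longrightarrow> C \<subseteq> R \<Longrightarrow> is_clique C \<Longrightarrow> card C \<le> omega R"
  unfolding omega_def by (intro Max_ge) auto

lemma omega_attained:
  assumes "finite R"
  obtains K where "K \<subseteq> R" "is_clique K" "card K = omega R"
proof -
  have "{} \<in> {C. C \<subseteq> R \<and> is_clique C}" by (auto simp: is_clique_def)
  then have "omega R \<in> card ` {C. C \<subseteq> R \<and> is_clique C}"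
    unfolding omega_def using assms by (intro Max_in) auto
  then show thesis using that by force
qed

lemma omega_mono:
  assumes "finite S" "R \<subseteq> S"
  shows "omega R \<le> omega S"
proof -
  obtain K where "K \<subseteq> R" "is_clique K" "card K = omega R"
    using omega_attained[of R] finite_subset[OF assms(2,1)] by blast
  then show ?thesis using omega_ge[OF assms(1), of K] assms(2) by simp
qed

lemma omega_less:
  assumes "finite R" "\<not> cminor R t"
  shows "omega R < t"
proof (rule ccontr)
  assume *: "\<not> omega R < t"
  obtain K where "K \<subseteq> R" "is_clique K" "card K = omega R" using omega_attained[OF assms(1)] .
  then have "cminor R (omega R)" using clique_minor[OF assms(1)] by metis
  then show False using * assms(2) cminor_antimono by auto
qed

text \<open>
  Outside a maximum clique, pairs of vertices without common non-neighbours can be formed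
  greedily, and each pair is a branch set.
\<close>

lemma large_excess_vertex:
  assumes fin: "finite R" and free: "\<not> cminor R t" and ex: "2 * t \<le> card R + omega R"
  shows "\<exists>v\<in>R. card R + omega R + 1 - 2 * t < (card (nonnb R v)) ^ 2"
proof (rule ccontr)
  assume "\<not> ?thesis"
  then have small: "(card (nonnb R v)) ^ 2 \<le> card R + omega R + 1 - 2 * t" if "v \<in> R" for v using that by force
  have om: "omega R < t" using omega_less fin free by blast
  then have ne: "R \<noteq> {}" using ex by auto
  obtain K where K: "K \<subseteq> R" "is_clique K" "card K = omega R" using omega_attained[OF fin] .
  define q where "q = Max ((\<lambda>v. card (nonnb R v)) ` R)"
  have "q \<in> (\<lambda>v. card (nonnb R v)) ` R" unfolding q_def using fin ne by (intro Max_in) auto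
  then have q2: "q ^ 2 \<le> card R + omega R + 1 - 2 * t" using small by force
  have q: "card (nonnb R v) \<le> q" if "v \<in> R" for v unfolding q_def using fin that by (intro Max_ge) auto
  have "card (R - K) = card R - omega R" using K fin by (metis card_Diff_subset finite_subset)
  moreover have "omega R \<le> card R" using K card_mono[OF fin K(1)] by simp
  \<comment> \<open>As \<open>card (R - K)\<close> is \<open>card R - omega R\<close>, this is
    \<open>q2\<close> rearranged, which explains the form of the excess.\<close>
  ultimately have size: "(q ^ 2 + 1) + 2 * (t - omega R) \<le> card (R - K) + 2" using q2 om ex by linarith
  have "cminor R (card K + (t - omega R))"
  proof (rule greedy_minor[OF fin K(1,2) _ _ _ size])
    show "\<exists>T\<subseteq>U'. card T \<le> 2 \<and> conn T \<and> (\<forall>v\<in>R. \<exists>s\<in>T. adj v s)"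
      if "U' \<subseteq> R - K" "q ^ 2 + 1 \<le> card U'" for U'
      using dominating_pair[OF fin, of U' q] q that by auto
  qed auto
  then show False using free om K(3) by simp
qed

text \<open>With excess \<open>e\<close>, a vertex from \<open>large_excess_vertex\<close> has more
  than \<open>sqrt e\<close> non-neighbours, so choosing it leaves an excess of at most
  \<open>e - sqrt e\<close> and lowers \<open>2 * sqrt e\<close> by at least 1. At a leaf the size
  is at most \<open>2 * t - omega R - 1\<close>, the order of the Turan graph with
  \<open>omega R\<close> parts.\<close>

lemma peel_excess:
  assumes fin: "finite R\<^sub>0" and free: "\<not> cminor R\<^sub>0 t"
    and n: "2 * sqrt (real (card R\<^sub>0 + omega R\<^sub>0)) \<le> real n" and M: "0 < M"
    and leaf: "\<And>R i. R \<subseteq> R\<^sub>0 \<Longrightarrow> card R + omega R < 2 * t \<Longrightarrow> i \<le> j \<Longrightarrow> j \<le> i + n \<Longrightarrow> ncl R i \<le> M"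
  shows "ncl R\<^sub>0 j \<le> (card R\<^sub>0 + 1) ^ n * M"
proof (rule peeling[where \<phi> = "\<lambda>R. 2 * sqrt (real (card R + omega R + 1 - 2 * t))" and stop = "\<lambda>R. card R + omega R < 2 * t"])
  have finR: "finite R" if "R \<subseteq> R\<^sub>0" for R using that fin finite_subset by blast
  show "2 * sqrt (real (card (R - {v}) + omega (R - {v}) + 1 - 2 * t)) \<le> 2 * sqrt (real (card R + omega R + 1 - 2 * t))"
    if "R \<subseteq> R\<^sub>0" "v \<in> R" for R v
  proof -
    have "card (R - {v}) + omega (R - {v}) + 1 - 2 * t \<le> card R + omega R + 1 - 2 * t"
      using omega_mono[of R "R - {v}"] card_Diff1_le[of R v] finR[OF that(1)] by (intro diff_le_mono add_mono) auto
    then show ?thesis by simp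
  qed
  show "2 * sqrt (real (card R\<^sub>0 + omega R\<^sub>0 + 1 - 2 * t)) \<le> real n"
  proof -
    have "omega R\<^sub>0 < t" using omega_less fin free by blast
    then have "card R\<^sub>0 + omega R\<^sub>0 + 1 - 2 * t \<le> card R\<^sub>0 + omega R\<^sub>0" by linarith
    then have "2 * sqrt (real (card R\<^sub>0 + omega R\<^sub>0 + 1 - 2 * t)) \<le> 2 * sqrt (real (card R\<^sub>0 + omega R\<^sub>0))" by simp
    then show ?thesis using n by linarith
  qed
  show "\<exists>v\<in>R. 2 * sqrt (real (card (nb R v) + omega (nb R v) + 1 - 2 * t)) + 1 \<le> 2 * sqrt (real (card R + omega R + 1 - 2 * t))"
    if R: "R \<subseteq> R\<^sub>0" "\<not> card R + omega R < 2 * t" for R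
  proof -
    have fR: "finite R" using finR R(1) .
    have "\<not> cminor R t" using cminor_mono[OF _ R(1)] free by blast
    then obtain v where v: "v \<in> R" "card R + omega R + 1 - 2 * t < (card (nonnb R v)) ^ 2"
      using large_excess_vertex[OF fR, of t] R(2) by auto
    define e where "e = real (card R + omega R + 1 - 2 * t)"
    define s where "s = sqrt e"
    define e' where "e' = real (card (nb R v) + omega (nb R v) + 1 - 2 * t)"
    define a where "a = real (card (nonnb R v))"
    have e1: "1 \<le> e" unfolding e_def using R(2) by linarith
    have s1: "1 \<le> s" unfolding s_def using e1 by simp
    have ss: "s * s = e" unfolding s_def using e1 by simp
    have "e < a ^ 2" unfolding e_def a_def using v(2) by (simp flip: of_nat_power)
    then have "s < a" unfolding s_def a_def using real_sqrt_less_mono by fastforce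
    \<comment> \<open>The maximum reflects truncated subtraction; its case 0 is covered by
      \<open>s \<le> e\<close>.\<close>
    moreover have "e' \<le> max 0 (e - a)"
    proof -
      have "omega (nb R v) \<le> omega R" using omega_mono[OF fR, of "nb R v"] by (auto simp: nb_def)
      then show ?thesis using card_nb_nonnb[OF fR, of v] R(2) unfolding e'_def e_def a_def by linarith
    qed
    moreover have "s \<le> e" using ss s1 mult_left_mono[of 1 s s] by simp
    ultimately have "e' \<le> e - s" by linarith
    also have "\<dots> \<le> (s - 1 / 2)\<^sup>2" using ss by (simp add: power2_eq_square algebra_simps)
    finally have "sqrt e' \<le> s - 1 / 2" using s1 by (intro real_le_lsqrt) auto
    then show ?thesis using v(1) unfolding e_def e'_def s_def by force
  qed
qed (use fin M leaf in auto)

end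

subsection \<open>Comparison with the extremal Turan graph\<close>

lemma es_add: "es (add_mset x M) k = es M k + (if k = 0 then 0 else x * es M (k - 1))"
  by (cases k) (auto simp: es_add_Suc)

lemma es_add_mono: "x \<le> y \<Longrightarrow> es (add_mset x M) k \<le> es (add_mset y M) k"
  by (simp add: es_add)

lemma es_union_mono: "es M k \<le> es (M + N) k"
  by (induction N) (auto simp: es_add intro: le_trans)

text \<open>Two parts enter \<open>es\<close> only through the sum and the product of their sizes.
  The move keeps the sum and does not lower the product.\<close>

lemma es_balance:
  assumes "y < a"
  shows "es (add_mset (Suc a) (add_mset y M)) k \<le> es (add_mset a (add_mset (Suc y) M)) k"
proof -
  have "Suc a * y \<le> a * Suc y" using assms by simp
  then have "Suc a * (y * e) \<le> a * (Suc y * e)" for e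
    using mult_le_mono1[of "Suc a * y" "a * Suc y" e] by (simp only: mult.assoc)
  then show ?thesis by (auto simp: es_add algebra_simps)
qed

definition balanced :: "nat multiset \<Rightarrow> bool" where
  "balanced M \<longleftrightarrow> (\<forall>x\<in>#M. \<forall>y\<in>#M. x \<le> Suc y)"

text \<open>Each balancing move lowers the sum of squares.\<close>

lemma exists_balanced:
  "\<exists>B. size B = size M \<and> sum_mset B = sum_mset M \<and> balanced B \<and> (\<forall>k. es M k \<le> es B k)"
proof (induction "\<Sum>x\<in>#M. x * x" arbitrary: M rule: less_induct)
  case less
  show ?case
  proof (cases "balanced M")
    case False
    then obtain x y where xy: "x \<in># M" "y \<in># M" "Suc y < x" unfolding balanced_def by force
    then obtain a where a: "x = Suc a" "y < a" by (cases x) auto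
    obtain M1 where M1: "M = add_mset x M1" using xy(1) by (metis mset_add)
    then have "y \<in># M1" using xy by auto
    then obtain M2 where "M1 = add_mset y M2" by (metis mset_add)
    then have M: "M = add_mset (Suc a) (add_mset y M2)" using M1 a by simp
    let ?M = "add_mset a (add_mset (Suc y) M2)"
    have "(\<Sum>x\<in>#?M. x * x) < (\<Sum>x\<in>#M. x * x)" using a(2) unfolding M by simp
    from less[OF this] obtain B where B: "size B = size ?M" "sum_mset B = sum_mset ?M" "balanced B"
      "\<forall>k. es ?M k \<le> es B k" by blast
    moreover have "es M k \<le> es ?M k" for k unfolding M by (rule es_balance[OF a(2)])
    ultimately show ?thesis using M by (intro exI[of _ B]) (auto intro: le_trans)
  qed auto
qed

text \<open>This lets any balanced multiset stand for the Turan graph. The minimum \<open>m\<close>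
  occurs, so fewer than \<open>size B\<close> entries exceed it: \<open>m\<close> is the quotient
  and their number the remainder.\<close>

lemma balanced_unique:
  assumes "balanced B" "B \<noteq> {#}"
  shows "B = replicate_mset (size B - sum_mset B mod size B) (sum_mset B div size B)
    + replicate_mset (sum_mset B mod size B) (Suc (sum_mset B div size B))"
proof -
  define m where "m = Min (set_mset B)"
  define w where "w = size B"
  define c where "c = size (filter_mset (\<lambda>x. x \<noteq> m) B)"
  have m: "m \<in># B" unfolding m_def using assms(2) by (intro Min_in) auto
  have le: "m \<le> x" if "x \<in># B" for x unfolding m_def using that by (intro Min_le) auto
  have up: "x \<le> Suc m" if "x \<in># B" for x using assms(1) that m unfolding balanced_def by blast
  have "filter_mset (\<lambda>x. x \<noteq> m) B = filter_mset (\<lambda>x. x = Suc m) B"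
    by (rule filter_mset_cong0) (use le up in \<open>fastforce simp: le_Suc_eq\<close>)
  then have f2: "filter_mset (\<lambda>x. x \<noteq> m) B = replicate_mset c (Suc m)"
    unfolding c_def by (simp add: filter_eq_replicate_mset)
  have f1: "filter_mset (\<lambda>x. x = m) B = replicate_mset (count B m) m" by (simp add: filter_eq_replicate_mset)
  have B: "B = replicate_mset (count B m) m + replicate_mset c (Suc m)"
    using multiset_partition[of B "\<lambda>x. x = m"] f1 f2 by simp
  have w: "w = count B m + c" unfolding w_def by (subst B) simp
  have "0 < count B m" using m by simp
  then have cw: "c < w" using w by simp
  have "sum_mset B = count B m * m + c * Suc m" by (subst B) simp
  then have s: "sum_mset B = m * w + c" unfolding w by (simp add: algebra_simps)
  have "sum_mset B div w = m" "sum_mset B mod w = c" using cw unfolding s by auto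
  then show ?thesis using B w unfolding w_def[symmetric] by simp
qed

lemma sum_mset_le_size: "(\<And>x. x \<in># M \<Longrightarrow> x \<le> 1) \<Longrightarrow> sum_mset M \<le> size M" for M :: "nat multiset"
proof (induction M)
  case (add x M)
  then have "x \<le> 1" "sum_mset M \<le> size M" by simp_all
  then show ?case by simp
qed simp

lemma balanced_pos:
  assumes "balanced B" "size B \<le> sum_mset B" "x \<in># B"
  shows "1 \<le> x"
proof (rule ccontr)
  assume "\<not> 1 \<le> x"
  then have "x = 0" by simp
  then have "0 \<in># B" using assms(3) by simp
  then obtain B' where B': "B = add_mset 0 B'" by (metis mset_add)
  have "sum_mset B' \<le> size B'"
  proof (rule sum_mset_le_size)
    show "y \<le> 1" if "y \<in># B'" for y using assms(1) that unfolding balanced_def B' by auto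
  qed
  then show False using assms(2) unfolding B' by simp
qed

text \<open>While the total exceeds the number of parts, some part has at least two vertices.
  Removing one of them loses at most half of the cliques, because
  \<open>a + 2 \<le> 2 * (a + 1)\<close>.\<close>

lemma es_shrink:
  assumes "sum_mset M = s + d" "size M \<le> s"
  shows "\<exists>B. size B = size M \<and> sum_mset B = s \<and> es M j \<le> 2 ^ d * es B j"
  using assms
proof (induction d arbitrary: M)
  case 0
  then show ?case by (intro exI[of _ M]) simp
next
  case (Suc d)
  have "\<exists>x\<in>#M. 2 \<le> x"
  proof (rule ccontr)
    assume "\<not> ?thesis"
    then have "x \<le> 1" if "x \<in># M" for x using that by force
    then have "sum_mset M \<le> size M" by (rule sum_mset_le_size)
    then show False using Suc.prems by simp
  qed
  then obtain x where "x \<in># M" "2 \<le> x" by blast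
  then obtain a M' where M: "M = add_mset (Suc (Suc a)) M'"
    by (metis mset_add add_2_eq_Suc le_Suc_ex)
  obtain B where B: "size B = size (add_mset (Suc a) M')" "sum_mset B = s"
    "es (add_mset (Suc a) M') j \<le> 2 ^ d * es B j"
    using Suc.IH[of "add_mset (Suc a) M'"] Suc.prems unfolding M by auto
  have "es M j \<le> 2 * es (add_mset (Suc a) M') j" unfolding M by (auto simp: es_add)
  then show ?case using B unfolding M by (intro exI[of _ B]) auto
qed

text \<open>A total that is too small is corrected by enlarging one part at no cost, the truncated
  exponent being 0. Balancing afterwards does not lower the count.\<close>

lemma es_resize:
  assumes "M \<noteq> {#}" "size M \<le> s"
  obtains B where "size B = size M" "sum_mset B = s" "balanced B" "es M j \<le> 2 ^ (sum_mset M - s) * es B j"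
proof -
  have "\<exists>B. size B = size M \<and> sum_mset B = s \<and> es M j \<le> 2 ^ (sum_mset M - s) * es B j"
  proof (cases "sum_mset M \<le> s")
    case True
    obtain x M' where M: "M = add_mset x M'" using assms(1) by (metis multiset_cases)
    let ?B = "add_mset (x + (s - sum_mset M)) M'"
    have "es M j \<le> es ?B j" unfolding M by (rule es_add_mono) simp
    moreover have "sum_mset ?B = s" using True unfolding M by simp
    ultimately show ?thesis using True M by (intro exI[of _ ?B]) simp
  next
    case False
    then show ?thesis using es_shrink[of M s "sum_mset M - s" j] assms(2) by simp
  qed
  then obtain B' where B': "size B' = size M" "sum_mset B' = s" "es M j \<le> 2 ^ (sum_mset M - s) * es B' j"
    by blast
  obtain B where B: "size B = size B'" "sum_mset B = sum_mset B'" "balanced B" "\<forall>k. es B' k \<le> es B k"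
    using exists_balanced by blast
  have "es M j \<le> 2 ^ (sum_mset M - s) * es B j" using B'(3) B(4) by (meson le_trans mult_le_mono2)
  then show thesis using that B B' by simp
qed

text \<open>Double counting: a \<open>j\<close>-clique extends by a vertex of any part that it does not meet.\<close>

lemma es_double_count:
  assumes "\<And>x. x \<in># B \<Longrightarrow> 1 \<le> x"
  shows "size B * es B j \<le> j * es B j + Suc j * es B (Suc j)"
  using assms
proof (induction B arbitrary: j)
  case empty
  then show ?case by simp
next
  case (add x B)
  have IH: "size B * es B i \<le> i * es B i + Suc i * es B (Suc i)" for i using add by simp
  obtain x' where x: "x = Suc x'" using add.prems[of x] by (cases x) auto
  show ?case
  proof (cases j)
    case 0
    then show ?thesis using IH[of 0] add.prems[of x] by (simp add: es_add)
  next
    case (Suc i)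
    have "x * (size B * es B i) \<le> x * (i * es B i + Suc i * es B (Suc i))" using IH by (rule mult_le_mono2)
    then show ?thesis using IH[of j] unfolding Suc x by (simp add: es_add algebra_simps)
  qed
qed

text \<open>A clique with fewer than \<open>k\<close> vertices misses some part, so by double
  counting each added vertex costs at most a factor \<open>Suc i\<close>, hence
  \<open>t\<close>.\<close>

lemma es_extend:
  assumes "\<And>x. x \<in># B \<Longrightarrow> 1 \<le> x" "j \<le> k" "k \<le> size B" "k \<le> t"
  shows "es B j \<le> t ^ (k - j) * es B k"
  using assms(2)
proof (induction rule: inc_induct)
  case (step i)
  have "(i + 1) * es B i \<le> size B * es B i" using step assms(3) by (intro mult_le_mono1) simp
  then have "(i + 1) * es B i \<le> i * es B i + Suc i * es B (Suc i)"
    using es_double_count[of B i] assms(1) le_trans by blast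
  then have "es B i \<le> Suc i * es B (Suc i)" by (simp add: algebra_simps)
  also have "\<dots> \<le> t * es B (Suc i)" using step assms(4) by (intro mult_le_mono1) simp
  also have "\<dots> \<le> t * (t ^ (k - Suc i) * es B k)" using step.IH by (rule mult_le_mono2)
  also have "\<dots> = t ^ (k - i) * es B k" using step by (simp flip: power_Suc add: Suc_diff_Suc mult.assoc[symmetric])
  finally show ?case .
qed simp

text \<open>
  To compare \<open>j\<close>-cliques with \<open>k\<close>-cliques, singleton parts are added until there are at least
  \<open>k\<close> parts, the number of vertices is corrected, and the cliques are extended.
\<close>

lemma es_compare:
  assumes M: "sum_mset M + size M < 2 * t" "size M < t" and k: "1 \<le> k" "k < t" "j \<le> k"
  obtains B w where "w \<in> {k..t - 1}" "size B = w" "sum_mset B = 2 * t - w - 1" "balanced B"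
    "es M j \<le> (4 * t) ^ (k - j) * es B k"
proof -
  define w where "w = max (size M) k"
  define y where "y = w - size M"
  define M1 where "M1 = M + replicate_mset y 1"
  have w: "k \<le> w" "w < t" "size M \<le> w" using M k unfolding w_def by auto
  have size1: "size M1 = w" and sum1: "sum_mset M1 = sum_mset M + y"
    using w unfolding M1_def y_def by simp_all
  have "M1 \<noteq> {#}" using size1 w k by auto
  moreover have "size M1 \<le> 2 * t - w - 1" using size1 w by linarith
  ultimately obtain B where B: "size B = w" "sum_mset B = 2 * t - w - 1" "balanced B"
    "es M1 j \<le> 2 ^ (sum_mset M1 - (2 * t - w - 1)) * es B j"
    using es_resize[of M1 "2 * t - w - 1" j] size1 by metis
  have pos: "1 \<le> x" if "x \<in># B" for x
    using balanced_pos[OF B(3) _ that] B(1,2) w by linarith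
  have ext: "es B j \<le> t ^ (k - j) * es B k" using pos k w B(1) by (intro es_extend) auto
  have "es M j \<le> (4 * t) ^ (k - j) * es B k"
  proof (cases "size M < j")
    case True
    then show ?thesis by (simp add: es_eq_0)
  next
    case False
    \<comment> \<open>With fewer than \<open>j\<close> parts there was nothing to count, so at most
      \<open>k - j\<close> parts were added.\<close>
    have "y \<le> k - j" using False unfolding y_def w_def by auto
    \<comment> \<open>The new parts bring \<open>y\<close> vertices, and the target shrinks by
      another \<open>y\<close>; this is the source of the 4 in \<open>4 * t\<close>.\<close>
    moreover have "sum_mset M1 - (2 * t - w - 1) \<le> 2 * y"
      using M(1) w unfolding sum1 y_def by linarith
    ultimately have exp: "sum_mset M1 - (2 * t - w - 1) \<le> 2 * (k - j)" by linarith
    have "es M j \<le> es M1 j" unfolding M1_def by (rule es_union_mono)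
    also note B(4)
    also have "2 ^ (sum_mset M1 - (2 * t - w - 1)) * es B j \<le> 2 ^ (2 * (k - j)) * (t ^ (k - j) * es B k)"
      using exp ext by (intro mult_le_mono power_increasing) auto
    also have "\<dots> = (4 * t) ^ (k - j) * es B k"
      by (simp add: power_mult power_mult_distrib mult.assoc)
    finally show ?thesis .
  qed
  moreover have "w \<in> {k..t - 1}" using w by simp
  ultimately show thesis using that[OF _ B(1-3)] by blast
qed

section \<open>Clique counts of complete multipartite graphs\<close>

lemma num_cliques_eq_ncl:
  assumes "ugraph (\<lambda>u v. {u, v} \<in> E)" "finite V"
  shows "num_cliques k V E = ugraph.ncl (\<lambda>u v. {u, v} \<in> E) V k"
proof -
  interpret ugraph "\<lambda>u v. {u, v} \<in> E" by (rule assms)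
  have "{K \<in> [V]\<^bsup>k\<^esup>. clique K E} = {C. C \<subseteq> V \<and> card C = k \<and> is_clique C}"
    using finite_subset[OF _ assms(2)] by (auto simp: nsets_def clique_def is_clique_def)
  then show ?thesis by (simp add: num_cliques_def ncl_def)
qed

lemma num_cliques_multipartite:
  assumes P: "partition_on V P" and fin: "finite V"
  shows "num_cliques k V (complete_multipartite_edges P) = es (image_mset card (mset_set P)) k"
proof -
  let ?adj = "\<lambda>u v. {u, v} \<in> complete_multipartite_edges P"
  have disj: "p = q" if "p \<in> P" "q \<in> P" "x \<in> p" "x \<in> q" for p q x
    using P that unfolding partition_on_def disjoint_def by blast
  have adj: "?adj u v \<longleftrightarrow> (\<exists>p\<in>P. \<exists>q\<in>P. p \<noteq> q \<and> u \<in> p \<and> v \<in> q)" for u v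
  proof
    assume "?adj u v"
    then obtain x y p q where "{u, v} = {x, y}" "p \<in> P" "q \<in> P" "p \<noteq> q" "x \<in> p" "y \<in> q"
      unfolding complete_multipartite_edges_def by blast
    then show "\<exists>p\<in>P. \<exists>q\<in>P. p \<noteq> q \<and> u \<in> p \<and> v \<in> q" unfolding doubleton_eq_iff by metis
  qed (unfold complete_multipartite_edges_def, blast)
  interpret ugraph ?adj
  proof
    show "?adj v u" if "?adj u v" for u v using that by (simp add: insert_commute)
    show "\<not> ?adj v v" for v unfolding adj using disj by blast
  qed
  have finP: "finite P" using P fin finite_elements by blast
  \<comment> \<open>A part is added vertex by vertex: each new vertex sees all of \<open>U\<close>
    and nothing of its own part.\<close>
  have part: "ncl (s \<union> U) (Suc i) = ncl U (Suc i) + card s * ncl U i"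
    if s: "finite s" "s \<subseteq> p" and p: "p \<in> P" "p \<notin> P'" and P': "P' \<subseteq> P" and U: "U = \<Union>P'" for s p P' U i
    using s
  proof (induction s rule: finite_induct)
    case (insert x s)
    have "U \<subseteq> V" using P P' U unfolding partition_on_def by blast
    then have finU: "finite (s \<union> U)" using insert.hyps(1) fin by (simp add: finite_subset)
    have "x \<notin> U" using disj[of p _ x] p P' U insert.prems by blast
    moreover have "nb (s \<union> U) x = U"
    proof (intro equalityI subsetI)
      fix u assume "u \<in> nb (s \<union> U) x"
      then have "u \<in> s \<union> U" "?adj x u" by (simp_all add: nb_def)
      then obtain p' q where u: "u \<in> s \<union> U" "p' \<in> P" "q \<in> P" "p' \<noteq> q" "x \<in> p'" "u \<in> q"
        unfolding adj by blast
      have "p' = p" using disj[OF u(2) p(1) u(5)] insert.prems by blast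
      then have "u \<notin> p" using disj[OF u(3) p(1) u(6)] u(4) by blast
      then show "u \<in> U" using u(1) insert.prems by blast
    next
      fix u assume u: "u \<in> U"
      then obtain q where q: "q \<in> P'" "u \<in> q" using U by blast
      then have "q \<in> P" "p \<noteq> q" using P' p(2) by auto
      then have "?adj x u" using p(1) q(2) insert.prems unfolding adj by blast
      then show "u \<in> nb (s \<union> U) x" using u by (simp add: nb_def)
    qed
    ultimately show ?case using ncl_insert[OF finU, of x i] insert by simp
  qed simp
  have "ncl (\<Union>P') k = es (image_mset card (mset_set P')) k" if "finite P'" "P' \<subseteq> P" for P' k
    using that
  proof (induction P' arbitrary: k rule: finite_induct)
    case empty
    then show ?case by (simp add: ncl_empty es_empty)
  next
    case (insert p P')
    have "\<Union>(insert p P') \<subseteq> V" using insert.prems P unfolding partition_on_def by blast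
    then have "finite (\<Union>(insert p P'))" using fin by (rule finite_subset)
    then have finp: "finite p" and "finite (p \<union> \<Union>P')" by auto
    then show ?case
      using part[OF finp subset_refl, of P' "\<Union>P'"] insert by (cases k) (auto simp: ncl_0 es_add_Suc)
  qed
  from this[OF finP subset_refl] show ?thesis
    using num_cliques_eq_ncl[OF ugraph_axioms fin] P unfolding partition_on_def by simp
qed

text \<open>Floor and ceiling differ by at most 1, so the part sizes are balanced and
  \<open>balanced_unique\<close> identifies them with \<open>B\<close>.\<close>

lemma num_cliques_turan:
  assumes T: "is_turan_graph N w V E" and B: "balanced B" "size B = w" "sum_mset B = N" "1 \<le> w"
  shows "num_cliques k V E = es B k"
proof -
  obtain P where P: "partition_on V P" "card P = w" "E = complete_multipartite_edges P"
    "\<forall>p\<in>P. int (card p) \<in> {\<lfloor>real N / real w\<rfloor>, \<lceil>real N / real w\<rceil>}"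
    and V: "finite V" "card V = N"
    using T unfolding is_turan_graph_def by blast
  have finP: "finite P" using P(1) V(1) finite_elements by blast
  let ?M = "image_mset card (mset_set P)"
  have c: "\<lceil>real N / real w\<rceil> \<le> \<lfloor>real N / real w\<rfloor> + 1" "\<lfloor>real N / real w\<rfloor> \<le> \<lceil>real N / real w\<rceil>"
    by linarith+
  have "balanced ?M" unfolding balanced_def
  proof (intro ballI)
    fix x y assume "x \<in># ?M" "y \<in># ?M"
    then obtain p q where "p \<in> P" "q \<in> P" "x = card p" "y = card q" using finP by auto
    then have "int x \<in> {\<lfloor>real N / real w\<rfloor>, \<lceil>real N / real w\<rceil>}" "int y \<in> {\<lfloor>real N / real w\<rfloor>, \<lceil>real N / real w\<rceil>}"
      using P(4) by auto
    then have "int x \<le> \<lceil>real N / real w\<rceil>" "\<lfloor>real N / real w\<rfloor> \<le> int y" using c(2) by auto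
    then show "x \<le> Suc y" using c(1) by linarith
  qed
  moreover have "size ?M = w" using P(2) by simp
  moreover have "sum_mset ?M = N"
  proof -
    have "(\<Sum>p\<in>P. card p) = card (\<Union>P)"
      using P(1) V(1) unfolding partition_on_def
      by (intro card_Union_disjoint[symmetric]) (auto intro: finite_subset)
    then show ?thesis using P(1) V(2) by (simp add: partition_on_def sum_unfold_sum_mset)
  qed
  moreover have "?M \<noteq> {#}" "B \<noteq> {#}" using \<open>size ?M = w\<close> B(2,4) by (metis not_one_le_zero size_empty)+
  ultimately have "?M = B" using balanced_unique[of ?M] balanced_unique[of B] B by simp
  then show ?thesis using num_cliques_multipartite[OF P(1) V(1)] P(3) by simp
qed

lemma extremal_turan_ge:
  assumes "is_extremal_turan t k V E" "1 \<le> k" "w \<in> {k..t - 1}" "size B = w" "sum_mset B = 2 * t - w - 1" "balanced B"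
  shows "es B k \<le> num_cliques k V E"
proof -
  have "1 \<le> w" "w \<le> 2 * t - w - 1" using assms(2,3) by auto
  then obtain V' :: "nat set" and E' where T: "is_turan_graph (2 * t - w - 1) w V' E'"
    using turan_graph_exists by blast
  have "num_cliques k V' E' \<le> num_cliques k V E"
    using assms(1,3) T unfolding is_extremal_turan_def by blast
  then show ?thesis using num_cliques_turan[OF T] assms \<open>1 \<le> w\<close> by simp
qed

section \<open>Combination of the peeling phases\<close>

context ugraph
begin

lemma ncl_le_extremal:
  assumes fin: "finite R" and free: "\<not> cminor R t" and ex: "card R + omega R < 2 * t"
    and k: "1 \<le> k" "k < t" "j \<le> k" and T: "is_extremal_turan t k V\<^sub>T E\<^sub>T"
  shows "ncl R j \<le> (4 * t) ^ (k - j) * num_cliques k V\<^sub>T E\<^sub>T"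
proof -
  obtain M where M: "size M = omega R" "sum_mset M = card R" "ncl R j \<le> es M j"
    using Zykov[OF fin omega_ge[OF fin], of j] .
  have "omega R < t" using omega_less fin free by blast
  then obtain B w where B: "w \<in> {k..t - 1}" "size B = w" "sum_mset B = 2 * t - w - 1" "balanced B"
    "es M j \<le> (4 * t) ^ (k - j) * es B k"
    using es_compare[of M t k j] M ex k by metis
  have "es B k \<le> num_cliques k V\<^sub>T E\<^sub>T" using extremal_turan_ge[OF T k(1) B(1-4)] .
  then show ?thesis using M(3) B(5) by (meson le_trans mult_le_mono2)
qed

text \<open>The comparison is applied to the empty multiset, which has one clique of order
  0.\<close>

lemma num_cliques_extremal_pos:
  assumes "is_extremal_turan t k V\<^sub>T E\<^sub>T" "1 \<le> k" "k < t"
  shows "0 < num_cliques k V\<^sub>T E\<^sub>T"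
proof -
  have "sum_mset {#} + size ({#} :: nat multiset) < 2 * t" "size ({#} :: nat multiset) < t"
    using assms(3) by simp_all
  then obtain B w where B: "w \<in> {k..t - 1}" "size B = w" "sum_mset B = 2 * t - w - 1" "balanced B"
    "es {#} 0 \<le> (4 * t) ^ (k - 0) * es B k"
    using es_compare[OF _ _ assms(2,3) le0] by blast
  then have "0 < es B k" by (cases "es B k") auto
  then show ?thesis using extremal_turan_ge[OF assms(1,2) B(1-4)] by simp
qed

text \<open>A degenerate order reduces to \<open>j\<close>-cliques in sets of fewer than
  \<open>t ^ 3\<close> vertices; \<open>peel_sparse\<close> leads below \<open>80 * t\<close>
  vertices and \<open>peel_excess\<close> to \<open>card R + omega R < 2 * t\<close>, where Zykov's
  theorem applies. The bounds at these three stages are \<open>?M3\<close>, \<open>?M2\<close> and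
  \<open>?M1\<close>.\<close>

lemma ncl_minor_free:
  assumes fin: "finite V" and free: "\<not> cminor V t" and T: "is_extremal_turan t k V\<^sub>T E\<^sub>T"
    and k: "1 \<le> k" "k < t"
    and t: "100 \<le> t" and large: "\<And>D. t ^ 2 \<le> D \<Longrightarrow> \<exists>r. D < 3 ^ r \<and> 8 * r * t + 21 \<le> D"
    and b: "3 \<le> b" "t ^ 3 \<le> b ^ 20" and n1: "2 * real b * ln (real (t ^ 3)) \<le> real n\<^sub>1"
    and n2: "18 * sqrt (real t) \<le> real n\<^sub>2"
  shows "ncl V k \<le> card V * (t ^ (5 * n\<^sub>1 + 4 * n\<^sub>2 + 2) * num_cliques k V\<^sub>T E\<^sub>T)"
proof -
  let ?C = "num_cliques k V\<^sub>T E\<^sub>T"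
  obtain j where j: "k = Suc j" using k(1) by (cases k) auto
  \<comment> \<open>The exponent bounds the vertices already chosen: one in the degenerate order,
    then at most \<open>n\<^sub>1\<close> and \<open>n\<^sub>2\<close> in the two phases.\<close>
  let ?M1 = "(4 * t) ^ (1 + n\<^sub>1 + n\<^sub>2) * ?C"
  let ?M2 = "(80 * t) ^ n\<^sub>2 * ?M1"
  let ?M3 = "(t ^ 3) ^ n\<^sub>1 * ?M2"
  have C0: "0 < ?C" using num_cliques_extremal_pos[OF T k] .
  have freeR: "finite R" "\<not> cminor R t" if "R \<subseteq> V" for R
    using that fin free finite_subset cminor_mono by blast+
  have leaf: "ncl R i \<le> ?M1"
    if R: "R \<subseteq> V" "card R + omega R < 2 * t" and i: "i \<le> j" "j \<le> i + (n\<^sub>1 + n\<^sub>2)" for R i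
  proof -
    have "ncl R i \<le> (4 * t) ^ (k - i) * ?C"
      using ncl_le_extremal[OF freeR[OF R(1)] R(2) k _ T, of i] i j by simp
    also have "\<dots> \<le> ?M1" using i j t by (intro mult_le_mono1 power_increasing) auto
    finally show ?thesis .
  qed
  have phase2: "ncl R i \<le> ?M2"
    if R: "R \<subseteq> V" "card R < 80 * t" and i: "i \<le> j" "j \<le> i + n\<^sub>1" for R i
  proof -
    have "omega R < t" using omega_less freeR[OF R(1)] by blast
    \<comment> \<open>The 18 in \<open>n2\<close> is twice the square root of this 81.\<close>
    then have "real (card R + omega R) \<le> 81 * real t" using R(2) by linarith
    then have "sqrt (real (card R + omega R)) \<le> sqrt (81 * real t)" by (rule real_sqrt_le_mono)
    also have "\<dots> = 9 * sqrt (real t)" by (simp add: real_sqrt_mult)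
    finally have n: "2 * sqrt (real (card R + omega R)) \<le> real n\<^sub>2" using n2 by linarith
    have "ncl R i \<le> (card R + 1) ^ n\<^sub>2 * ?M1"
      by (rule peel_excess[OF freeR[OF R(1)] n]) (use C0 t leaf R(1) i in auto)
    also have "\<dots> \<le> ?M2" using R(2) by (intro mult_le_mono1 power_mono) auto
    finally show ?thesis .
  qed
  have phase1: "ncl R j \<le> ?M3" if R: "R \<subseteq> V" "card R < t ^ 3" for R
  proof -
    have "ln (real (card R)) \<le> ln (real (t ^ 3))"
      using R(2) t by (cases "card R = 0") (auto simp: ln_ge_zero ln_le_cancel_iff)
    then have n: "2 * real b * ln (real (card R)) \<le> real n\<^sub>1"
      using n1 mult_left_mono[of "ln (real (card R))" "ln (real (t ^ 3))" "2 * real b"] by simp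
    have "ncl R j \<le> (card R + 1) ^ n\<^sub>1 * ?M2"
    proof (rule peel_sparse[OF freeR[OF R(1)] b(1) _ _ n])
      \<comment> \<open>The choice \<open>r = 20\<close> turns \<open>4 * r * t\<close> into
        \<open>80 * t\<close>.\<close>
      show "card R < b ^ 20" using R(2) b(2) by simp
      show "ncl R' i \<le> ?M2" if "R' \<subseteq> R" "card R' < 4 * 20 * t" "i \<le> j" "j \<le> i + n\<^sub>1" for R' i
        using phase2[of R' i] that R(1) by auto
    qed (use C0 t in auto)
    also have "\<dots> \<le> ?M3" using R(2) by (intro mult_le_mono1 power_mono) auto
    finally show ?thesis .
  qed
  have "ncl V (Suc j) \<le> card V * ?M3"
  proof (rule degenerate_count[OF fin])
    show "\<exists>v\<in>R. card (nb R v) < t ^ 3" if "R \<subseteq> V" "R \<noteq> {}" for R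
      using min_degree_minor[OF freeR(1)[OF that(1)] that(2) large t] freeR(2)[OF that(1)] by force
  qed (use phase1 in auto)
  also have "\<dots> \<le> card V * (t ^ (5 * n\<^sub>1 + 4 * n\<^sub>2 + 2) * ?C)"
  proof -
    have "4 * t \<le> t ^ 2" "80 * t \<le> t ^ 2" using t by (simp_all add: power2_eq_square)
    then have "(t ^ 3) ^ n\<^sub>1 * ((80 * t) ^ n\<^sub>2 * (4 * t) ^ (1 + n\<^sub>1 + n\<^sub>2))
        \<le> (t ^ 3) ^ n\<^sub>1 * ((t ^ 2) ^ n\<^sub>2 * (t ^ 2) ^ (1 + n\<^sub>1 + n\<^sub>2))"
      by (intro mult_le_mono power_mono) auto
    also have "\<dots> = t ^ (3 * n\<^sub>1 + (2 * n\<^sub>2 + 2 * (1 + n\<^sub>1 + n\<^sub>2)))"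
      by (simp only: power_add power_mult)
    also have "3 * n\<^sub>1 + (2 * n\<^sub>2 + 2 * (1 + n\<^sub>1 + n\<^sub>2)) = 5 * n\<^sub>1 + 4 * n\<^sub>2 + 2" by simp
    finally have "(t ^ 3) ^ n\<^sub>1 * ((80 * t) ^ n\<^sub>2 * (4 * t) ^ (1 + n\<^sub>1 + n\<^sub>2)) * ?C
        \<le> t ^ (5 * n\<^sub>1 + 4 * n\<^sub>2 + 2) * ?C" by (rule mult_le_mono1)
    then show ?thesis by (simp only: mult.assoc mult_le_mono2)
  qed
  finally show ?thesis using j by simp
qed

end

lemma (in ugraph) has_complete_minor_if_cminor:
  assumes adj: "\<And>u v. adj u v \<longleftrightarrow> {u, v} \<in> E" and minor: "cminor V t"
  shows "has_complete_minor t V E"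
proof -
  obtain P where P: "branch_family V P" "card P = t" "\<forall>A\<in>P. \<forall>B\<in>P. A \<noteq> B \<longrightarrow> touch A B"
    using minor unfolding cminor_def by blast
  obtain \<phi> where \<phi>: "bij_betw \<phi> {..<t} P"
    using ex_bij_betw_nat_finite[of P] P(1,2) unfolding branch_family_def atLeast0LessThan by blast
  have mem: "\<phi> x \<in> P" if "x < t" for x using bij_betw_apply[OF \<phi>] that by simp
  have neq: "\<phi> x \<noteq> \<phi> y" if "x < t" "y < t" "x \<noteq> y" for x y
    using \<phi> that by (auto simp: bij_betw_def inj_on_def)
  have con: "induces_connected E A" if "conn A" for A
    using that unfolding conn_def induces_connected_def adj rtranclp_rtrancl_eq[symmetric] by simp
  show ?thesis unfolding has_complete_minor_def is_minor_def
  proof (intro exI[of _ \<phi>] conjI ballI impI)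
    show "\<phi> x \<subseteq> V" "induces_connected E (\<phi> x)" if "x \<in> {..<t}" for x
      using mem[of x] that P(1) con unfolding branch_family_def by auto
    show "disjoint_family_on \<phi> {..<t}" unfolding disjoint_family_on_def
    proof (intro ballI impI)
      fix x y assume xy: "x \<in> {..<t}" "y \<in> {..<t}" "x \<noteq> y"
      then show "\<phi> x \<inter> \<phi> y = {}"
        using P(1) mem[of x] mem[of y] neq[of x y] unfolding branch_family_def disjoint_def by simp
    qed
    fix x y assume xy: "x \<in> {..<t}" "y \<in> {..<t}" "{x, y} \<in> [{..<t}]\<^bsup>2\<^esup>"
    then have "x \<noteq> y" by (auto simp: nsets_def)
    then have "touch (\<phi> x) (\<phi> y)" using P(3) xy mem neq by auto
    then show "\<exists>u\<in>\<phi> x. \<exists>v\<in>\<phi> y. {u, v} \<in> E" unfolding touch_def adj .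
  qed
qed

section \<open>Growth conditions on \<open>t\<close>\<close>

definition large_enough :: "nat \<Rightarrow> bool" where
  "large_enough t \<longleftrightarrow> 100 \<le> t \<and>
    (\<forall>D. t ^ 2 \<le> D \<longrightarrow> (\<exists>r. D < 3 ^ r \<and> 8 * r * t + 21 \<le> D)) \<and>
    (\<exists>b. 3 \<le> b \<and> t ^ 3 \<le> b ^ 20 \<and> 2 * real b * ln (real (t ^ 3)) \<le> sqrt (real t)) \<and>
    log 2 (real t) * (77 * sqrt (real t) + 13) \<le> 8 * sqrt (real t) * log 2 (real t) powr (5 / 4)"

text \<open>Take \<open>r\<close> about \<open>sqrt D / 16\<close>. As
  \<open>t \<le> sqrt D\<close>, the term \<open>8 * r * t\<close> is at most half of
  \<open>D\<close>, and 21 fits into the other half. A threshold for \<open>D\<close> alone is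
  enough, because \<open>t \<le> D\<close>.\<close>

lemma dominating_size_exists:
  "\<forall>\<^sub>F t in sequentially. \<forall>D. t ^ 2 \<le> D \<longrightarrow> (\<exists>r. D < 3 ^ r \<and> 8 * r * t + 21 \<le> D)"
proof -
  have "\<forall>\<^sub>F D :: nat in sequentially. real D < 3 powr (sqrt (real D) / 16 - 1)" by real_asymp
  then obtain D\<^sub>0 where D0: "\<And>D. D\<^sub>0 \<le> D \<Longrightarrow> real D < 3 powr (sqrt (real D) / 16 - 1)"
    unfolding eventually_sequentially by blast
  have "\<exists>r. D < 3 ^ r \<and> 8 * r * t + 21 \<le> D" if t: "max D\<^sub>0 42 \<le> t" and D: "t ^ 2 \<le> D" for t D
  proof -
    define s where "s = sqrt (real D)"
    define r where "r = nat \<lfloor>s / 16\<rfloor>"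
    have "t * 1 \<le> t * t" using t by (intro mult_le_mono2) simp
    then have tD: "t \<le> D" using D unfolding power2_eq_square by linarith
    have s0: "0 \<le> s" and ss: "s * s = real D" unfolding s_def by simp_all
    have ts: "real t \<le> s"
    proof -
      have "real (t ^ 2) \<le> real D" using D by (simp only: of_nat_le_iff)
      then show ?thesis unfolding s_def by (intro real_le_rsqrt) simp
    qed
    have r: "s / 16 - 1 \<le> real r" "real r \<le> s / 16" unfolding r_def using s0 by linarith+
    have "real D < 3 powr (s / 16 - 1)" using D0[of D] t tD unfolding s_def by simp
    also have "\<dots> \<le> 3 powr (real r)" using r(1) by simp
    also have "\<dots> = real (3 ^ r)" by (simp add: powr_realpow)
    finally have "D < 3 ^ r" by (simp only: of_nat_less_iff)
    moreover have "8 * r * t + 21 \<le> D"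
    proof -
      have "real r * real t \<le> s / 16 * s" using r(2) ts s0 by (intro mult_mono) auto
      then have "16 * (real r * real t) \<le> real D" using ss by simp
      moreover have "42 \<le> real D" using t tD by linarith
      ultimately have "real (8 * r * t + 21) \<le> real D" by simp
      then show ?thesis by (simp only: of_nat_le_iff)
    qed
    ultimately show ?thesis by blast
  qed
  then show ?thesis unfolding eventually_sequentially by blast
qed

lemma eventually_large_enough: "\<forall>\<^sub>F t in sequentially. large_enough t"
proof -
  have 1: "\<forall>\<^sub>F t :: nat in sequentially. 100 \<le> t" by (rule eventually_ge_at_top)
  have 2: "\<forall>\<^sub>F t :: nat in sequentially. real t ^ 3 \<le> (real t powr (1 / 4) - 1) ^ 20" by real_asymp
  have 3: "\<forall>\<^sub>F t :: nat in sequentially. 2 * real t powr (1 / 4) * ln (real t ^ 3) \<le> sqrt (real t)" by real_asymp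
  have 4: "\<forall>\<^sub>F t :: nat in sequentially. 4 \<le> real t powr (1 / 4)" by real_asymp
  have 5: "\<forall>\<^sub>F t :: nat in sequentially.
      log 2 (real t) * (77 * sqrt (real t) + 13) \<le> 8 * sqrt (real t) * log 2 (real t) powr (5 / 4)"
    by real_asymp
  show ?thesis using 1 2 3 4 5 dominating_size_exists
  proof eventually_elim
    case (elim t)
    \<comment> \<open>The exponent 1/4 lies between 3/20, needed for
      \<open>t ^ 3 \<le> b ^ 20\<close>, and 1/2, needed to keep \<open>b\<close> times a logarithm
      below \<open>sqrt t\<close>.\<close>
    define b where "b = nat \<lfloor>real t powr (1 / 4)\<rfloor>"
    have b: "real t powr (1 / 4) - 1 \<le> real b" "real b \<le> real t powr (1 / 4)"
      unfolding b_def using elim(4) by linarith+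
    have "3 \<le> b" using b(1) elim(4) by linarith
    moreover have "t ^ 3 \<le> b ^ 20"
    proof -
      have "(real t powr (1 / 4) - 1) ^ 20 \<le> real b ^ 20" using b(1) elim(4) by (intro power_mono) auto
      then have "real (t ^ 3) \<le> real (b ^ 20)" using elim(2) by simp
      then show ?thesis by (simp only: of_nat_le_iff)
    qed
    moreover have "2 * real b * ln (real (t ^ 3)) \<le> sqrt (real t)"
    proof -
      have "1 \<le> real t ^ 3" using elim(1) by (intro one_le_power) simp
      then have "2 * real b * ln (real t ^ 3) \<le> 2 * real t powr (1 / 4) * ln (real t ^ 3)"
        using b(2) by (intro mult_right_mono) auto
      then show ?thesis using elim(3) by simp
    qed
    ultimately show ?case unfolding large_enough_def using elim by blast
  qed
qed

theorem theorem3p6: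
  fixes g :: "nat \<Rightarrow> real"
  assumes "filterlim g at_top sequentially"
  shows "\<exists>t\<^sub>0 :: nat. \<forall>t \<ge> t\<^sub>0. \<forall>k :: nat. 1 \<le> k \<longrightarrow> k < t \<longrightarrow>
    real (min k (t - k)) \<ge> g t * sqrt (real t) * log 2 (real t) powr (5 / 4) \<longrightarrow>
    (\<forall>(n :: nat) (V :: 'a set) (E :: 'a set set).
       simple_graph V E \<longrightarrow> card V = n \<longrightarrow> \<not> has_complete_minor t V E \<longrightarrow>
       (\<forall>V\<^sub>T E\<^sub>T. is_extremal_turan t k V\<^sub>T E\<^sub>T \<longrightarrow>
          real (num_cliques k V E) \<le>
            real n * (real (num_cliques k V\<^sub>T E\<^sub>T) / real (card V\<^sub>T)) *
            2 powr (8 * sqrt (real t) * log 2 (real t) powr (5 / 4))))"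
proof -
  obtain t\<^sub>0 where t0: "\<And>t. t\<^sub>0 \<le> t \<Longrightarrow> large_enough t"
    using eventually_large_enough unfolding eventually_sequentially by blast
  have "real (num_cliques k V E) \<le> real n * (real (num_cliques k V\<^sub>T E\<^sub>T) / real (card V\<^sub>T)) *
      2 powr (8 * sqrt (real t) * log 2 (real t) powr (5 / 4))"
    if t: "t\<^sub>0 \<le> t" and k: "1 \<le> k" "k < t" and G: "simple_graph V E" "card V = n"
      and free: "\<not> has_complete_minor t V E" and T: "is_extremal_turan t k V\<^sub>T E\<^sub>T"
    for t k n and V :: "'a set" and E V\<^sub>T E\<^sub>T
  proof -
    have fin: "finite V" and E: "E \<subseteq> [V]\<^bsup>2\<^esup>" using G(1) unfolding simple_graph_def by auto
    interpret ugraph "\<lambda>u v. {u, v} \<in> E"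
    proof
      show "{v, u} \<in> E" if "{u, v} \<in> E" for u v using that by (simp add: insert_commute)
      show "{v, v} \<notin> E" for v using E by (auto simp: nsets_def)
    qed
    have cfree: "\<not> cminor V t" using has_complete_minor_if_cminor[OF refl] free by blast
    have L: "large_enough t" using t0 t .
    then have t100: "100 \<le> t" and dom: "\<And>D. t ^ 2 \<le> D \<Longrightarrow> \<exists>r. D < 3 ^ r \<and> 8 * r * t + 21 \<le> D"
      and final: "log 2 (real t) * (77 * sqrt (real t) + 13) \<le> 8 * sqrt (real t) * log 2 (real t) powr (5 / 4)"
      unfolding large_enough_def by blast+
    obtain b where b: "3 \<le> b" "t ^ 3 \<le> b ^ 20" "2 * real b * ln (real (t ^ 3)) \<le> sqrt (real t)"
      using L unfolding large_enough_def by blast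
    define n\<^sub>1 where "n\<^sub>1 = nat \<lceil>sqrt (real t)\<rceil>"
    define n\<^sub>2 where "n\<^sub>2 = nat \<lceil>18 * sqrt (real t)\<rceil>"
    define N where "N = 5 * n\<^sub>1 + 4 * n\<^sub>2 + 2"
    have s0: "0 \<le> sqrt (real t)" by simp
    have n1: "sqrt (real t) \<le> real n\<^sub>1" "real n\<^sub>1 \<le> sqrt (real t) + 1"
      and n2: "18 * sqrt (real t) \<le> real n\<^sub>2" "real n\<^sub>2 \<le> 18 * sqrt (real t) + 1"
      unfolding n\<^sub>1_def n\<^sub>2_def using s0 by linarith+
    define C where "C = num_cliques k V\<^sub>T E\<^sub>T"
    have "ncl V k \<le> card V * (t ^ N * C)" unfolding N_def C_def
      using ncl_minor_free[OF fin cfree T k t100 dom b(1,2) _ n2(1), of n\<^sub>1] b(3) n1(1) by linarith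
    then have "num_cliques k V E \<le> n * (t ^ N * C)"
      using num_cliques_eq_ncl[OF ugraph_axioms fin] G(2) by simp
    then have bound: "real (num_cliques k V E) \<le> real n * (real (t ^ N) * real C)"
      by (simp only: of_nat_le_iff flip: of_nat_mult)
    obtain w where "w \<in> {k..t - 1}" "is_turan_graph (2 * t - w - 1) w V\<^sub>T E\<^sub>T"
      using T unfolding is_extremal_turan_def by blast
    then have card: "card V\<^sub>T = 2 * t - w - 1" "w < t" using k unfolding is_turan_graph_def by auto
    \<comment> \<open>The division by \<open>card V\<^sub>T\<close> is absorbed by raising the
      exponent \<open>N\<close> by 2.\<close>
    then have c0: "0 < card V\<^sub>T" and "card V\<^sub>T \<le> t ^ 2" using t100 by (auto simp: power2_eq_square intro: order_trans[of _ "2 * t"])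
    then have "t ^ N * card V\<^sub>T \<le> t ^ N * t ^ 2" by (intro mult_le_mono2)
    then have "real (t ^ N * card V\<^sub>T) \<le> real (t ^ (N + 2))" by (simp only: of_nat_le_iff power_add)
    also have "\<dots> = 2 powr (log 2 (real t) * real (N + 2))"
    proof -
      have "real (t ^ (N + 2)) = real t powr real (N + 2)"
        unfolding of_nat_power by (rule powr_realpow[symmetric]) (use t100 in simp)
      also have "real t powr real (N + 2) = (2 powr log 2 (real t)) powr real (N + 2)" using t100 by simp
      finally show ?thesis by (simp only: powr_powr)
    qed
    also have "\<dots> \<le> 2 powr (log 2 (real t) * (77 * sqrt (real t) + 13))"
    proof -
      \<comment> \<open>With \<open>s = sqrt t\<close> the bound is
        \<open>5 * (s + 1) + 4 * (18 * s + 1) + 4\<close>.\<close>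
      have "real (N + 2) \<le> 77 * sqrt (real t) + 13" unfolding N_def using n1(2) n2(2) by simp
      then show ?thesis using t100 by (intro powr_mono mult_left_mono) auto
    qed
    \<comment> \<open>The spare factor \<open>log 2 t powr (1 / 4)\<close> outgrows the constant
      77/8.\<close>
    also have "\<dots> \<le> 2 powr (8 * sqrt (real t) * log 2 (real t) powr (5 / 4))"
      using final by (intro powr_mono) auto
    finally have "real (t ^ N) \<le> 2 powr (8 * sqrt (real t) * log 2 (real t) powr (5 / 4)) / real (card V\<^sub>T)"
      using c0 by (simp add: field_simps)
    then have "real n * (real (t ^ N) * real C)
        \<le> real n * (2 powr (8 * sqrt (real t) * log 2 (real t) powr (5 / 4)) / real (card V\<^sub>T) * real C)"
      by (intro mult_left_mono mult_right_mono) auto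
    also have "\<dots> = real n * (real C / real (card V\<^sub>T)) * 2 powr (8 * sqrt (real t) * log 2 (real t) powr (5 / 4))"
      by simp
    finally show ?thesis using bound unfolding C_def by linarith
  qed
  then show ?thesis by blast
qed

end
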